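(* Let $k\ge 0$, let $\mathfrak g$ be a finite-dimensional complex reductive Lie algebra with its fixed nondegenerate trace form $\langle\,,\rangle$, and let $M,N,V$ be finite-dimensional simple $\mathfrak g$-modules. Then there is an algebra homomorphism $$\Phi:\mathcal G_k\to \mathrm{End}_{\mathfrak g}(M\otimes N\otimes V^{\otimes k})$$ from the degenerate two-boundary braid algebra $\mathcal G_k$, defined by $$\Phi(x_i)=\tfrac12(\kappa_{M,\le i}-\kappa_{M,\le i-1}),\qquad \Phi(y_i)=\tfrac12(\kappa_{N,\le i}-\kappa_{N,\le i-1}),$$ $$\Phi(z_i)=\tfrac12(\kappa_{M\otimes N,\le i}-\kappa_{M\otimes N,\le i-1}+\kappa_V)\qquad\text{for }1\le i\le k,$$ $$\Phi(z_0)=\tfrac12(\kappa_{M\otimes N}-\kappa_M-\kappa_N)=\gamma_{M,N},$$ $$\Phi(t_{s_i})=\mathrm{id}_M\otimes \mathrm{id}_N\otimes \mathrm{id}_V^{\otimes(i-1)}\otimes s\otimes \mathrm{id}_V^{\otimes(k-i-1)}\qquad\text{for }1\le i\le k-1,$$ where $s\cdot(u\otimes v)=v\otimes u$ on $V\otimes V$.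
   Context: **The algebra $\mathcal G_k$.** Let $S_k$ be the symmetric group, $s_i=(i\ i{+}1)$. The degenerate two-boundary braid algebra $\mathcal G_k$ is the unital associative $\mathbb C$-algebra generated by $t_w$ ($w\in S_k$), $x_1,\dots,x_k$, $y_1,\dots,y_k$, $z_0,z_1,\dots,z_k$, subject to the relations below. Here $m_1=0$ and, for $j>1$, $m_j=\sum_{1\le i<j}m_{i,j}$, where $m_{j-1,j}=x_j-t_{s_{j-1}}x_{j-1}t_{s_{j-1}}$ and $m_{i,j}=t_{(i\ j-1)}\,m_{j-1,j}\,t_{(i\ j-1)}$ for $1\le i<j-1$. - $z_i=x_i+y_i-m_i$ for $1\le i\le k$; - $t_wt_{w'}=t_{ww'}$ for $w,w'\in S_k$ (with $t_e=1$); - $x_ix_j=x_jx_i$, $y_iy_j=y_jy_i$, $z_iz_j=z_jz_i$ for all admissible $i,j$; - $t_{s_i}x_j=x_jt_{s_i}$, $t_{s_i}y_j=y_jt_{s_i}$, $t_{s_i}z_j=z_jt_{s_i}$ for $j\ne i,i+1$; - $(z_0+\cdots+z_i)x_j=x_j(z_0+\cdots+z_i)$ and $(z_0+\cdots+z_i)y_j=y_j(z_0+\cdots+z_i)$ for $i\ge j$; - $t_{s_i}(x_i+x_{i+1})=(x_i+x_{i+1})t_{s_i}$ and $t_{s_i}(y_i+y_{i+1})=(y_i+y_{i+1})t_{s_i}$ for $1\le i\le k-1$; - $t_{s_i}t_{s_{i+1}}(x_{i+1}-t_{s_i}x_it_{s_i})t_{s_{i+1}}t_{s_i}=x_{i+2}-t_{s_{i+1}}x_{i+1}t_{s_{i+1}}$,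 and the same with $y$ in place of $x$, for $1\le i\le k-2$; - $x_{i+1}-t_{s_i}x_it_{s_i}=y_{i+1}-t_{s_i}y_it_{s_i}$ for $1\le i\le k-1$. **Operators.** Fix a finite-dimensional faithful representation $\theta$ of $\mathfrak g$ whose trace form $\langle x,y\rangle=\mathrm{tr}(\theta(x)\theta(y))$ is nondegenerate on $\mathfrak g$ and on its Cartan subalgebra. Let $\{b_i\}$ be a basis of $\mathfrak g$ with dual basis $\{b_i^*\}$ with respect to $\langle\,,\rangle$. The Casimir element is $\kappa=\sum_i b_ib_i^*\in \mathcal U\mathfrak g$, and $\gamma=\sum_i b_i\otimes b_i^*$; $\kappa$ acts on $U\otimes U'$ as $\kappa\otimes \mathrm{id}+\mathrm{id}\otimes\kappa+2\gamma$. On $M\otimes N\otimes V^{\otimes k}$, for $X=M$, $N$ or $M\otimes N$ (or $V$): $\kappa_X$ is $\kappa$ acting on the factor $X$ ($\kappa_V$ is the scalar by which $\kappa$ acts on the simple module $V$); $\kappa_{X,\le j}$ is $\kappa$ acting on the tensor product of $X$ with the first $j$ copies of $V$ (identity on the other factors), with $\kappa_{X,\le 0}=\kappa_X$; $\gamma_{M,N}$ is $\gamma$ acting on the factors $M$ and $N$. $\mathrm{End}_{\mathfrak g}(U)$ is the algebra of linear endomorphisms of $U$ commuting with the $\mathfrak g$-action. *)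

theory Defs
  imports
    Complex_Main
    "HOL-Library.Poly_Mapping"
    "HOL-Library.FuncSet"
    "HOL-Combinatorics.Permutations"
    "HOL-Algebra.QuotRing"
    "HOL-Algebra.Module"
begin

section \<open>Complex vector spaces\<close>

class complex_vector = ab_group_add +
  fixes scaleC :: "complex \<Rightarrow> 'a \<Rightarrow> 'a"  (infixr \<open>*\<^sub>C\<close> 75)
  assumes scaleC_add_right: "a *\<^sub>C (x + y) = a *\<^sub>C x + a *\<^sub>C y"
    and scaleC_add_left: "(a + b) *\<^sub>C x = a *\<^sub>C x + b *\<^sub>C x"
    and scaleC_scaleC: "a *\<^sub>C (b *\<^sub>C x) = (a * b) *\<^sub>C x"
    and scaleC_one: "1 *\<^sub>C x = x"

global_interpretation cvec: vector_space "scaleC :: complex \<Rightarrow> 'a \<Rightarrow> 'a::complex_vector"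
  by unfold_locales
    (simp_all add: scaleC_add_right scaleC_add_left scaleC_scaleC scaleC_one)

abbreviation clinear :: "('a::complex_vector \<Rightarrow> 'b::complex_vector) \<Rightarrow> bool" where
  "clinear \<equiv> Vector_Spaces.linear scaleC scaleC"

lemma clinearI:
  assumes "\<And>x y. f (x + y) = f x + f y" "\<And>c x. f (c *\<^sub>C x) = c *\<^sub>C f x"
  shows "clinear f"
  by unfold_locales (simp_all add: assms)

definition finite_dim :: "'a::complex_vector itself \<Rightarrow> bool" where
  "finite_dim _ \<longleftrightarrow> (\<exists>B :: 'a set. finite B \<and> cvec.span B = UNIV)"

definition is_cbasis :: "'a::complex_vector set \<Rightarrow> bool" where
  "is_cbasis B \<longleftrightarrow> cvec.independent B \<and> cvec.span B = UNIV"

definition ctrace :: "('a::complex_vector \<Rightarrow> 'a) \<Rightarrow> complex" where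
  "ctrace f = (let B = (SOME B. is_cbasis B) in \<Sum>b\<in>B. cvec.representation B (f b) b)"

instantiation complex :: complex_vector
begin

definition scaleC_complex :: "complex \<Rightarrow> complex \<Rightarrow> complex" where
  "scaleC_complex c z = c * z"

instance
  by standard (simp_all add: scaleC_complex_def algebra_simps)

end

text \<open>In particular \<open>'a \<Rightarrow>\<^sub>0 complex\<close> is the free vector space on \<open>'a\<close>, with basis vectors
  \<open>Poly_Mapping.single x 1\<close>.\<close>

instantiation poly_mapping :: (type, complex_vector) complex_vector
begin

lift_definition scaleC_poly_mapping :: "complex \<Rightarrow> ('a \<Rightarrow>\<^sub>0 'b) \<Rightarrow> ('a \<Rightarrow>\<^sub>0 'b)"
  is "\<lambda>c f x. c *\<^sub>C f x"
  by (erule finite_subset [rotated]) auto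

instance
  by standard
    (transfer; simp add: fun_eq_iff scaleC_add_right scaleC_add_left scaleC_scaleC scaleC_one)+

end


section \<open>Lie algebras and their modules\<close>

definition lie_algebra :: "('g::complex_vector \<Rightarrow> 'g \<Rightarrow> 'g) \<Rightarrow> bool" where
  "lie_algebra br \<longleftrightarrow>
     (\<forall>x. clinear (br x)) \<and> (\<forall>y. clinear (\<lambda>x. br x y)) \<and>
     (\<forall>x. br x x = 0) \<and>
     (\<forall>x y z. br x (br y z) + br y (br z x) + br z (br x y) = 0)"

definition lie_ideal :: "('g::complex_vector \<Rightarrow> 'g \<Rightarrow> 'g) \<Rightarrow> 'g set \<Rightarrow> bool" where
  "lie_ideal br I \<longleftrightarrow> cvec.subspace I \<and> (\<forall>x. \<forall>y\<in>I. br x y \<in> I)"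

text \<open>Every ideal has a complementary ideal, i.e. the adjoint representation is completely
  reducible.\<close>

definition reductive :: "('g::complex_vector \<Rightarrow> 'g \<Rightarrow> 'g) \<Rightarrow> bool" where
  "reductive br \<longleftrightarrow> lie_algebra br \<and>
     (\<forall>I. lie_ideal br I \<longrightarrow>
       (\<exists>J. lie_ideal br J \<and> I \<inter> J = {0} \<and> (\<forall>x. \<exists>a\<in>I. \<exists>b\<in>J. x = a + b)))"

definition lie_subalgebra :: "('g::complex_vector \<Rightarrow> 'g \<Rightarrow> 'g) \<Rightarrow> 'g set \<Rightarrow> bool" where
  "lie_subalgebra br H \<longleftrightarrow> cvec.subspace H \<and> (\<forall>x\<in>H. \<forall>y\<in>H. br x y \<in> H)"

primrec lower_central :: "('g::complex_vector \<Rightarrow> 'g \<Rightarrow> 'g) \<Rightarrow> 'g set \<Rightarrow> nat \<Rightarrow> 'g set" where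
  "lower_central br H 0 = H"
| "lower_central br H (Suc n) = cvec.span {br x y | x y. x \<in> H \<and> y \<in> lower_central br H n}"

text \<open>A Cartan subalgebra is a nilpotent subalgebra that equals its own normalizer.\<close>

definition cartan_subalgebra :: "('g::complex_vector \<Rightarrow> 'g \<Rightarrow> 'g) \<Rightarrow> 'g set \<Rightarrow> bool" where
  "cartan_subalgebra br H \<longleftrightarrow> lie_subalgebra br H \<and>
     (\<exists>n. lower_central br H n = {0}) \<and> {x. \<forall>y\<in>H. br x y \<in> H} = H"

definition lie_module ::
  "('g::complex_vector \<Rightarrow> 'g \<Rightarrow> 'g) \<Rightarrow> ('g \<Rightarrow> 'u::complex_vector \<Rightarrow> 'u) \<Rightarrow> bool" where
  "lie_module br \<rho> \<longleftrightarrow>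
     (\<forall>x. clinear (\<rho> x)) \<and> (\<forall>u. clinear (\<lambda>x. \<rho> x u)) \<and>
     (\<forall>x y u. \<rho> (br x y) u = \<rho> x (\<rho> y u) - \<rho> y (\<rho> x u))"

definition simple_module ::
  "('g::complex_vector \<Rightarrow> 'g \<Rightarrow> 'g) \<Rightarrow> ('g \<Rightarrow> 'u::complex_vector \<Rightarrow> 'u) \<Rightarrow> bool" where
  "simple_module br \<rho> \<longleftrightarrow> lie_module br \<rho> \<and> (UNIV :: 'u set) \<noteq> {0} \<and>
     (\<forall>W. cvec.subspace W \<and> (\<forall>x. \<forall>w\<in>W. \<rho> x w \<in> W) \<longrightarrow> W = {0} \<or> W = UNIV)"

definition trace_form :: "('g \<Rightarrow> 'w::complex_vector \<Rightarrow> 'w) \<Rightarrow> 'g \<Rightarrow> 'g \<Rightarrow> complex" where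
  "trace_form \<theta> x y = ctrace (\<theta> x \<circ> \<theta> y)"

definition nondegenerate_on :: "'g::zero set \<Rightarrow> ('g \<Rightarrow> 'g \<Rightarrow> complex) \<Rightarrow> bool" where
  "nondegenerate_on S B \<longleftrightarrow> (\<forall>x\<in>S. (\<forall>y\<in>S. B x y = 0) \<longrightarrow> x = 0)"

text \<open>\<open>b 0, \<dots>, b (d - 1)\<close> is a basis and \<open>b' 0, \<dots>, b' (d - 1)\<close> is its dual basis with respect
  to \<open>B\<close>.\<close>

definition dual_bases ::
  "('g::complex_vector \<Rightarrow> 'g \<Rightarrow> complex) \<Rightarrow> nat \<Rightarrow> (nat \<Rightarrow> 'g) \<Rightarrow> (nat \<Rightarrow> 'g) \<Rightarrow> bool" where
  "dual_bases B d b b' \<longleftrightarrow>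
     inj_on b {..<d} \<and> is_cbasis (b ` {..<d}) \<and>
     inj_on b' {..<d} \<and> is_cbasis (b' ` {..<d}) \<and>
     (\<forall>i<d. \<forall>j<d. B (b i) (b' j) = (if i = j then 1 else 0))"

text \<open>The operator by which the element \<open>\<kappa> = (\<Sum>i<d. b i * b' i)\<close> of the enveloping algebra acts
  when the Lie algebra acts by \<open>\<rho>\<close>.\<close>

definition casimir_op ::
  "nat \<Rightarrow> (nat \<Rightarrow> 'g) \<Rightarrow> (nat \<Rightarrow> 'g) \<Rightarrow> ('g \<Rightarrow> 'u \<Rightarrow> 'u) \<Rightarrow> 'u \<Rightarrow> 'u::complex_vector" where
  "casimir_op d b b' \<rho> u = (\<Sum>i<d. \<rho> (b i) (\<rho> (b' i) u))"

text \<open>The scalar exists by Schur's lemma when \<open>\<rho>\<close> is finite-dimensional and simple.\<close>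

definition casimir_scalar ::
  "nat \<Rightarrow> (nat \<Rightarrow> 'g) \<Rightarrow> (nat \<Rightarrow> 'g) \<Rightarrow> ('g \<Rightarrow> 'u \<Rightarrow> 'u::complex_vector) \<Rightarrow> complex" where
  "casimir_scalar d b b' \<rho> = (THE c. \<forall>u. casimir_op d b b' \<rho> u = c *\<^sub>C u)"


section \<open>Tensor products\<close>

text \<open>Types cannot depend on \<open>k\<close>.  The type \<open>('m, 'n, 'v) tensor\<close> is the direct sum over all \<open>k\<close> of
  the spaces \<open>M \<otimes> N \<otimes> V\<^bsup>\<otimes>k\<^esup>\<close>: the free vector space on all \<open>(m, n, [v\<^sub>1, \<dots>, v\<^sub>k])\<close> modulo
  multilinearity in every entry.  Each relation only involves lists of one length, so
  \<open>M \<otimes> N \<otimes> V\<^bsup>\<otimes>k\<^esup>\<close> is the span \<open>tensor_power k\<close> of the pure tensors with \<open>k\<close> entries from \<open>V\<close>.\<close>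

type_synonym ('m, 'n, 'v) pretensor = "('m \<times> 'n \<times> 'v list) \<Rightarrow>\<^sub>0 complex"

abbreviation pre_pure :: "'m \<Rightarrow> 'n \<Rightarrow> 'v list \<Rightarrow> ('m, 'n, 'v) pretensor" where
  "pre_pure m n vs \<equiv> Poly_Mapping.single (m, n, vs) 1"

definition multilinear_relations ::
  "('m::complex_vector, 'n::complex_vector, 'v::complex_vector) pretensor set" where
  "multilinear_relations =
     {pre_pure (c *\<^sub>C m + m') n vs - (c *\<^sub>C pre_pure m n vs + pre_pure m' n vs)
        | c m m' n vs. True} \<union>
     {pre_pure m (c *\<^sub>C n + n') vs - (c *\<^sub>C pre_pure m n vs + pre_pure m n' vs)
        | c m n n' vs. True} \<union>
     {pre_pure m n (us @ (c *\<^sub>C v + v') # ws)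
        - (c *\<^sub>C pre_pure m n (us @ v # ws) + pre_pure m n (us @ v' # ws))
        | c m n us v v' ws. True}"

definition tensor_rel ::
  "('m::complex_vector, 'n::complex_vector, 'v::complex_vector) pretensor
     \<Rightarrow> ('m, 'n, 'v) pretensor \<Rightarrow> bool" where
  "tensor_rel f g \<longleftrightarrow> f - g \<in> cvec.span multilinear_relations"

lemma tensor_rel_refl: "tensor_rel f f"
  by (simp add: tensor_rel_def cvec.span_zero)

quotient_type (overloaded) ('m, 'n, 'v) tensor =
  "('m::complex_vector, 'n::complex_vector, 'v::complex_vector) pretensor" / tensor_rel
proof (rule equivpI)
  show "reflp (tensor_rel :: ('m, 'n, 'v) pretensor \<Rightarrow> _)"
    by (simp add: reflp_def tensor_rel_refl)
  show "symp (tensor_rel :: ('m, 'n, 'v) pretensor \<Rightarrow> _)"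
    unfolding symp_def tensor_rel_def by (metis cvec.span_neg minus_diff_eq)
  show "transp (tensor_rel :: ('m, 'n, 'v) pretensor \<Rightarrow> _)"
  proof (rule transpI)
    fix x y z :: "('m, 'n, 'v) pretensor"
    assume "tensor_rel x y" "tensor_rel y z"
    then have "(x - y) + (y - z) \<in> cvec.span multilinear_relations"
      unfolding tensor_rel_def by (rule cvec.span_add)
    then show "tensor_rel x z"
      by (simp add: tensor_rel_def)
  qed
qed

instantiation tensor :: (complex_vector, complex_vector, complex_vector) complex_vector
begin

lift_definition zero_tensor :: "('a, 'b, 'c) tensor" is 0 .

lift_definition plus_tensor ::
    "('a, 'b, 'c) tensor \<Rightarrow> ('a, 'b, 'c) tensor \<Rightarrow> ('a, 'b, 'c) tensor" is "(+)"
  unfolding tensor_rel_def by (metis add_diff_add cvec.span_add)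

lift_definition uminus_tensor :: "('a, 'b, 'c) tensor \<Rightarrow> ('a, 'b, 'c) tensor" is uminus
  unfolding tensor_rel_def by (metis cvec.span_neg minus_diff_minus)

lift_definition minus_tensor ::
    "('a, 'b, 'c) tensor \<Rightarrow> ('a, 'b, 'c) tensor \<Rightarrow> ('a, 'b, 'c) tensor" is "(-)"
proof -
  fix a a' b b' :: "('a, 'b, 'c) pretensor"
  assume "tensor_rel a a'" "tensor_rel b b'"
  then have "(a - a') - (b - b') \<in> cvec.span multilinear_relations"
    unfolding tensor_rel_def by (rule cvec.span_diff)
  then show "tensor_rel (a - b) (a' - b')"
    by (simp add: tensor_rel_def algebra_simps)
qed

lift_definition scaleC_tensor :: "complex \<Rightarrow> ('a, 'b, 'c) tensor \<Rightarrow> ('a, 'b, 'c) tensor" is scaleC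
  unfolding tensor_rel_def by (metis cvec.scale_right_diff_distrib cvec.span_scale)

instance
proof
  fix a b c :: "('a, 'b, 'c) tensor" and r s :: complex
  show "a + b + c = a + (b + c)"
    by transfer (simp add: add.assoc tensor_rel_refl)
  show "a + b = b + a"
    by transfer (simp add: add.commute tensor_rel_refl)
  show "0 + a = a"
    by transfer (simp add: tensor_rel_refl)
  show "- a + a = 0"
    by transfer (simp add: tensor_rel_refl)
  show "a - b = a + - b"
    by transfer (simp add: tensor_rel_refl)
  show "r *\<^sub>C (a + b) = r *\<^sub>C a + r *\<^sub>C b"
    by transfer (simp add: scaleC_add_right tensor_rel_refl)
  show "(r + s) *\<^sub>C a = r *\<^sub>C a + s *\<^sub>C a"
    by transfer (simp add: scaleC_add_left tensor_rel_refl)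
  show "r *\<^sub>C s *\<^sub>C a = (r * s) *\<^sub>C a"
    by transfer (simp add: scaleC_scaleC tensor_rel_refl)
  show "1 *\<^sub>C a = a"
    by transfer (simp add: scaleC_one tensor_rel_refl)
qed

end

lift_definition pure_tensor ::
  "'m::complex_vector \<Rightarrow> 'n::complex_vector \<Rightarrow> 'v::complex_vector list \<Rightarrow> ('m, 'n, 'v) tensor"
  is pre_pure .

definition tensor_power ::
  "nat \<Rightarrow> ('m::complex_vector, 'n::complex_vector, 'v::complex_vector) tensor set" where
  "tensor_power k = cvec.span {pure_tensor m n vs | m n vs. length vs = k}"

definition multilinear ::
  "('m::complex_vector \<Rightarrow> 'n::complex_vector \<Rightarrow> 'v::complex_vector list \<Rightarrow> 'u::complex_vector)
     \<Rightarrow> bool" where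
  "multilinear F \<longleftrightarrow>
     (\<forall>c m m' n vs. F (c *\<^sub>C m + m') n vs = c *\<^sub>C F m n vs + F m' n vs) \<and>
     (\<forall>c m n n' vs. F m (c *\<^sub>C n + n') vs = c *\<^sub>C F m n vs + F m n' vs) \<and>
     (\<forall>c m n us v v' ws. F m n (us @ (c *\<^sub>C v + v') # ws)
        = c *\<^sub>C F m n (us @ v # ws) + F m n (us @ v' # ws))"

text \<open>The linear map with prescribed values on pure tensors; it exists and is unique if these
  values are multilinear, see \<open>tensor_lift_linear\<close> and \<open>tensor_lift_pure\<close>.\<close>

definition tensor_lift ::
  "('m::complex_vector \<Rightarrow> 'n::complex_vector \<Rightarrow> 'v::complex_vector list \<Rightarrow> 'u::complex_vector)
     \<Rightarrow> ('m, 'n, 'v) tensor \<Rightarrow> 'u" where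
  "tensor_lift F = (THE f. clinear f \<and> (\<forall>m n vs. f (pure_tensor m n vs) = F m n vs))"

lemma clinear_module_hom: "clinear f \<Longrightarrow> module_hom scaleC scaleC f"
  by (simp add: Vector_Spaces.linear_def)

lemmas clinear_add = module_hom.add[OF clinear_module_hom]
  and clinear_scale = module_hom.scale[OF clinear_module_hom]
  and clinear_diff = module_hom.diff[OF clinear_module_hom]
  and clinear_zero = module_hom.zero[OF clinear_module_hom]

lemma pretensor_induct [case_names zero pure add scale]:
  fixes f :: "'a \<Rightarrow>\<^sub>0 complex"
  assumes "P 0" "\<And>x. P (Poly_Mapping.single x 1)"
    "\<And>f g. P f \<Longrightarrow> P g \<Longrightarrow> P (f + g)" "\<And>c f. P f \<Longrightarrow> P (c *\<^sub>C f)"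
  shows "P f"
proof -
  have eq: "f = (\<Sum>x\<in>Poly_Mapping.keys f. Poly_Mapping.lookup f x *\<^sub>C Poly_Mapping.single x 1)"
    (is "f = ?s")
  proof (rule poly_mapping_eqI)
    fix y
    have "Poly_Mapping.lookup ?s y =
        (\<Sum>x\<in>Poly_Mapping.keys f. if x = y then Poly_Mapping.lookup f x else 0)"
      unfolding lookup_sum
      by (rule sum.cong)
        (auto simp: scaleC_poly_mapping.rep_eq scaleC_complex_def lookup_single when_def)
    also have "\<dots> = Poly_Mapping.lookup f y"
      by (subst sum.delta) (auto simp: in_keys_iff)
    finally show "Poly_Mapping.lookup f y = Poly_Mapping.lookup ?s y"
      by (rule sym)
  qed
  have sums: "P (\<Sum>x\<in>A. h x)" if "\<And>x. P (h x)" for h :: "'a \<Rightarrow> ('a \<Rightarrow>\<^sub>0 complex)" and A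
    by (induction A rule: infinite_finite_induct) (simp_all add: assms(1,3) that)
  have "P ?s"
    by (rule sums, rule assms(4), rule assms(2))
  then show ?thesis
    by (simp only: eq[symmetric])
qed

lemma tensor_lift_ex1:
  fixes F :: "'m::complex_vector \<Rightarrow> 'n::complex_vector \<Rightarrow> 'v::complex_vector list
    \<Rightarrow> 'u::complex_vector"
  assumes "multilinear F"
  shows "\<exists>!f. clinear f \<and> (\<forall>m n vs. f (pure_tensor m n vs) = F m n vs)"
proof -
  define F' where "F' = (\<lambda>(m, n, vs). F m n vs)"
  define g where "g f = (\<Sum>p\<in>Poly_Mapping.keys f. Poly_Mapping.lookup f p *\<^sub>C F' p)"
    for f :: "('m, 'n, 'v) pretensor"
  have g: "g f = (\<Sum>p\<in>A. Poly_Mapping.lookup f p *\<^sub>C F' p)"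
    if "finite A" "Poly_Mapping.keys f \<subseteq> A" for f A
    unfolding g_def using that by (intro sum.mono_neutral_left) (auto simp: in_keys_iff)
  have lin: "clinear g"
  proof (rule clinearI)
    fix x y :: "('m, 'n, 'v) pretensor" and c :: complex
    show "g (x + y) = g x + g y"
      unfolding g_def
      by (rule setsum_keys_plus_distrib) (simp_all add: scaleC_add_left)
    have "Poly_Mapping.keys (c *\<^sub>C x) \<subseteq> Poly_Mapping.keys x"
      by (auto simp: in_keys_iff scaleC_poly_mapping.rep_eq)
    from g[OF finite_keys this] show "g (c *\<^sub>C x) = c *\<^sub>C g x"
      by (simp add: g_def scaleC_poly_mapping.rep_eq scaleC_complex_def
          cvec.scale_sum_right scaleC_scaleC)
  qed
  have gp: "g (pre_pure m n vs) = F m n vs" for m n vs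
    by (simp add: g_def F'_def scaleC_one)
  have rel: "g x = 0" if "x \<in> multilinear_relations" for x
    using that assms unfolding multilinear_relations_def multilinear_def
    by (auto simp: gp clinear_add[OF lin] clinear_scale[OF lin] clinear_diff[OF lin])
  have ker: "g x = 0" if "x \<in> cvec.span multilinear_relations" for x
    using that
    by (induction rule: cvec.span_induct_alt)
      (simp_all add: rel clinear_add[OF lin] clinear_scale[OF lin] clinear_zero[OF lin])
  have inv: "g x = g y" if "tensor_rel x y" for x y
    using ker[of "x - y"] that by (simp add: tensor_rel_def clinear_diff[OF lin])
  have gabs: "g (rep_tensor (abs_tensor x)) = g x" for x
    by (rule inv) (simp add: Quotient3_rel_rep Quotient3_rep_abs Quotient3_tensor tensor_rel_refl)
  define f where "f t = g (rep_tensor t)" for t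
  have "clinear f"
  proof (rule clinearI)
    fix x y :: "('m, 'n, 'v) tensor" and c :: complex
    show "f (x + y) = f x + f y"
      by (induction x rule: tensor.abs_induct, induction y rule: tensor.abs_induct)
        (simp add: f_def gabs plus_tensor.abs_eq clinear_add[OF lin])
    show "f (c *\<^sub>C x) = c *\<^sub>C f x"
      by (induction x rule: tensor.abs_induct)
        (simp add: f_def gabs scaleC_tensor.abs_eq clinear_scale[OF lin])
  qed
  moreover have "f (pure_tensor m n vs) = F m n vs" for m n vs
    by (simp add: f_def pure_tensor.abs_eq gabs gp)
  moreover have "f1 = f2"
    if 1: "clinear f1" "\<And>m n vs. f1 (pure_tensor m n vs) = F m n vs"
      and 2: "clinear f2" "\<And>m n vs. f2 (pure_tensor m n vs) = F m n vs" for f1 f2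
  proof
    fix t :: "('m, 'n, 'v) tensor"
    have "f1 (abs_tensor x) = f2 (abs_tensor x)" for x
    proof (induction x rule: pretensor_induct)
      case zero
      then show ?case
        by (simp flip: zero_tensor.abs_eq add: clinear_zero 1(1) 2(1))
    next
      case (pure x)
      then show ?case
        by (cases x) (simp flip: pure_tensor.abs_eq add: 1(2) 2(2))
    next
      case (add x y)
      then show ?case
        by (simp flip: plus_tensor.abs_eq add: clinear_add 1(1) 2(1))
    next
      case (scale c x)
      then show ?case
        by (simp flip: scaleC_tensor.abs_eq add: clinear_scale 1(1) 2(1))
    qed
    then show "f1 t = f2 t"
      by (rule tensor.abs_induct)
  qed
  ultimately show ?thesis
    by blast
qed

lemma tensor_lift_linear: "multilinear F \<Longrightarrow> clinear (tensor_lift F)"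
  and tensor_lift_pure: "multilinear F \<Longrightarrow> tensor_lift F (pure_tensor m n vs) = F m n vs"
  using theI'[OF tensor_lift_ex1, of F] unfolding tensor_lift_def by blast+


section \<open>Operators on the tensor space\<close>

text \<open>The tensor factors of \<open>M \<otimes> N \<otimes> V\<^bsup>\<otimes>k\<^esup>\<close>; the copies of \<open>V\<close> are numbered from 1.\<close>

datatype slot = SlotM | SlotN | SlotV nat

text \<open>\<open>x\<close> acting on a single tensor factor (trivially on pure tensors lacking this factor).\<close>

definition slot_act ::
  "('g \<Rightarrow> 'm \<Rightarrow> 'm) \<Rightarrow> ('g \<Rightarrow> 'n \<Rightarrow> 'n) \<Rightarrow> ('g \<Rightarrow> 'v \<Rightarrow> 'v) \<Rightarrow> slot \<Rightarrow> 'g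
     \<Rightarrow> ('m::complex_vector, 'n::complex_vector, 'v::complex_vector) tensor
     \<Rightarrow> ('m, 'n, 'v) tensor" where
  "slot_act \<rho>M \<rho>N \<rho>V p x = tensor_lift (\<lambda>m n vs.
     case p of
       SlotM \<Rightarrow> pure_tensor (\<rho>M x m) n vs
     | SlotN \<Rightarrow> pure_tensor m (\<rho>N x n) vs
     | SlotV j \<Rightarrow> pure_tensor m n (vs[j - 1 := \<rho>V x (vs ! (j - 1))]))"

text \<open>\<open>x\<close> acting by the Leibniz rule on the tensor product of the factors in \<open>S\<close>, and as the
  identity on the remaining factors.\<close>

definition slots_act ::
  "('g \<Rightarrow> 'm \<Rightarrow> 'm) \<Rightarrow> ('g \<Rightarrow> 'n \<Rightarrow> 'n) \<Rightarrow> ('g \<Rightarrow> 'v \<Rightarrow> 'v) \<Rightarrow> slot set \<Rightarrow> 'g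
     \<Rightarrow> ('m::complex_vector, 'n::complex_vector, 'v::complex_vector) tensor
     \<Rightarrow> ('m, 'n, 'v) tensor" where
  "slots_act \<rho>M \<rho>N \<rho>V S x u = (\<Sum>p\<in>S. slot_act \<rho>M \<rho>N \<rho>V p x u)"

definition first_copies :: "nat \<Rightarrow> slot set" where
  "first_copies j = SlotV ` {1..j}"

definition gamma_MN ::
  "nat \<Rightarrow> (nat \<Rightarrow> 'g) \<Rightarrow> (nat \<Rightarrow> 'g)
     \<Rightarrow> ('g \<Rightarrow> 'm \<Rightarrow> 'm) \<Rightarrow> ('g \<Rightarrow> 'n \<Rightarrow> 'n)
     \<Rightarrow> ('m::complex_vector, 'n::complex_vector, 'v::complex_vector) tensor
     \<Rightarrow> ('m, 'n, 'v) tensor" where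
  "gamma_MN d b b' \<rho>M \<rho>N =
     tensor_lift (\<lambda>m n vs. \<Sum>i<d. pure_tensor (\<rho>M (b i) m) (\<rho>N (b' i) n) vs)"

text \<open>The flip of the \<open>i\<close>-th and \<open>i + 1\<close>-st copy of \<open>V\<close>, which are the list entries with indices
  \<open>i - 1\<close> and \<open>i\<close>.\<close>

definition flip_op ::
  "nat \<Rightarrow> ('m::complex_vector, 'n::complex_vector, 'v::complex_vector) tensor
     \<Rightarrow> ('m, 'n, 'v) tensor" where
  "flip_op i = tensor_lift (\<lambda>m n vs.
     if i < length vs then pure_tensor m n (vs[i - 1 := vs ! i, i := vs ! (i - 1)])
     else pure_tensor m n vs)"

text \<open>The algebra of linear endomorphisms of a subspace \<open>U\<close> that commute with the action \<open>\<rho>\<close>.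
  Endomorphisms of \<open>U\<close> are represented by functions that are \<open>undefined\<close> outside \<open>U\<close>.\<close>

definition End_algebra ::
  "('g \<Rightarrow> 'u \<Rightarrow> 'u) \<Rightarrow> 'u set \<Rightarrow> (complex, 'u \<Rightarrow> 'u::complex_vector) module" where
  "End_algebra \<rho> U =
     \<lparr>carrier = {f \<in> U \<rightarrow>\<^sub>E U.
        (\<forall>u\<in>U. \<forall>v\<in>U. f (u + v) = f u + f v) \<and>
        (\<forall>c. \<forall>u\<in>U. f (c *\<^sub>C u) = c *\<^sub>C f u) \<and>
        (\<forall>x. \<forall>u\<in>U. f (\<rho> x u) = \<rho> x (f u))},
      mult = (\<lambda>f g. compose U f g),
      one = (\<lambda>u\<in>U. u),
      zero = (\<lambda>u\<in>U. 0),
      add = (\<lambda>f g. \<lambda>u\<in>U. f u + g u),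
      smult = (\<lambda>c f. \<lambda>u\<in>U. c *\<^sub>C f u)\<rparr>"


section \<open>Associative algebras given by generators and relations\<close>

text \<open>Words under concatenation; \<open>'a list \<Rightarrow>\<^sub>0 complex\<close> thereby becomes a ring under convolution,
  the ring of noncommutative polynomials in the letters \<open>'a\<close>.\<close>

instantiation list :: (type) monoid_add
begin

definition zero_list :: "'a list" where "zero_list = []"
definition plus_list :: "'a list \<Rightarrow> 'a list \<Rightarrow> 'a list" where "plus_list = (@)"

instance
  by standard (simp_all add: zero_list_def plus_list_def)

end

definition free_algebra :: "'a set \<Rightarrow> (complex, 'a list \<Rightarrow>\<^sub>0 complex) module" where
  "free_algebra G =
     \<lparr>carrier = {f. Poly_Mapping.keys f \<subseteq> lists G},
      mult = (*), one = 1, zero = 0, add = (+), smult = scaleC\<rparr>"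

definition quotient_algebra ::
  "(complex, 'a) module \<Rightarrow> 'a set \<Rightarrow> (complex, 'a set) module" where
  "quotient_algebra A I =
     \<lparr>carrier = carrier (A Quot I), mult = mult (A Quot I), one = one (A Quot I),
      zero = zero (A Quot I), add = add (A Quot I),
      smult = (\<lambda>c C. \<Union>a\<in>C. I +>\<^bsub>A\<^esub> (c \<odot>\<^bsub>A\<^esub> a))\<rparr>"

definition relation_ideal ::
  "'a set \<Rightarrow> (('a list \<Rightarrow>\<^sub>0 complex) \<times> ('a list \<Rightarrow>\<^sub>0 complex)) set \<Rightarrow> ('a list \<Rightarrow>\<^sub>0 complex) set" where
  "relation_ideal G R = Idl\<^bsub>free_algebra G\<^esub> {l - r | l r. (l, r) \<in> R}"

definition presented_algebra ::
  "'a set \<Rightarrow> (('a list \<Rightarrow>\<^sub>0 complex) \<times> ('a list \<Rightarrow>\<^sub>0 complex)) set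
     \<Rightarrow> (complex, ('a list \<Rightarrow>\<^sub>0 complex) set) module" where
  "presented_algebra G R = quotient_algebra (free_algebra G) (relation_ideal G R)"

definition algebra_hom ::
  "(complex, 'a) module \<Rightarrow> (complex, 'b) module \<Rightarrow> ('a \<Rightarrow> 'b) set" where
  "algebra_hom A B =
     {h \<in> ring_hom A B. \<forall>c. \<forall>a\<in>carrier A. h (c \<odot>\<^bsub>A\<^esub> a) = c \<odot>\<^bsub>B\<^esub> h a}"


section \<open>The degenerate two-boundary braid algebra\<close>

datatype gen = GenT "nat \<Rightarrow> nat" | GenX nat | GenY nat | GenZ nat

definition dtb_generators :: "nat \<Rightarrow> gen set" where
  "dtb_generators k =
     {GenT w | w. w permutes {1..k}} \<union> GenX ` {1..k} \<union> GenY ` {1..k} \<union> GenZ ` {0..k}"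

type_synonym free_elt = "gen list \<Rightarrow>\<^sub>0 complex"

definition ft :: "(nat \<Rightarrow> nat) \<Rightarrow> free_elt" where "ft w = Poly_Mapping.single [GenT w] 1"
definition fx :: "nat \<Rightarrow> free_elt" where "fx i = Poly_Mapping.single [GenX i] 1"
definition fy :: "nat \<Rightarrow> free_elt" where "fy i = Poly_Mapping.single [GenY i] 1"
definition fz :: "nat \<Rightarrow> free_elt" where "fz i = Poly_Mapping.single [GenZ i] 1"

definition sref :: "nat \<Rightarrow> nat \<Rightarrow> nat" where
  "sref i = Transposition.transpose i (i + 1)"

abbreviation fs :: "nat \<Rightarrow> free_elt" where "fs i \<equiv> ft (sref i)"

definition fm_pair :: "nat \<Rightarrow> nat \<Rightarrow> free_elt" where
  "fm_pair i j =
     (let m = fx j - fs (j - 1) * fx (j - 1) * fs (j - 1);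
          t = ft (Transposition.transpose i (j - 1))
      in if i = j - 1 then m else t * m * t)"

definition fm :: "nat \<Rightarrow> free_elt" where
  "fm j = (\<Sum>i\<in>{1..<j}. fm_pair i j)"

definition dtb_relations :: "nat \<Rightarrow> (free_elt \<times> free_elt) set" where
  "dtb_relations k =
     {(fz i, fx i + fy i - fm i) | i. i \<in> {1..k}} \<union>
     {(ft w * ft w', ft (w \<circ> w')) | w w'. w permutes {1..k} \<and> w' permutes {1..k}} \<union>
     {(ft id, 1)} \<union>
     {(fx i * fx j, fx j * fx i) | i j. i \<in> {1..k} \<and> j \<in> {1..k}} \<union>
     {(fy i * fy j, fy j * fy i) | i j. i \<in> {1..k} \<and> j \<in> {1..k}} \<union>
     {(fz i * fz j, fz j * fz i) | i j. i \<in> {0..k} \<and> j \<in> {0..k}} \<union>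
     {(fs i * fx j, fx j * fs i) | i j. i \<in> {1..<k} \<and> j \<in> {1..k} \<and> j \<noteq> i \<and> j \<noteq> i + 1} \<union>
     {(fs i * fy j, fy j * fs i) | i j. i \<in> {1..<k} \<and> j \<in> {1..k} \<and> j \<noteq> i \<and> j \<noteq> i + 1} \<union>
     {(fs i * fz j, fz j * fs i) | i j. i \<in> {1..<k} \<and> j \<in> {0..k} \<and> j \<noteq> i \<and> j \<noteq> i + 1} \<union>
     {((\<Sum>l\<in>{0..i}. fz l) * fx j, fx j * (\<Sum>l\<in>{0..i}. fz l))
        | i j. i \<in> {1..k} \<and> j \<in> {1..k} \<and> i \<ge> j} \<union>
     {((\<Sum>l\<in>{0..i}. fz l) * fy j, fy j * (\<Sum>l\<in>{0..i}. fz l))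
        | i j. i \<in> {1..k} \<and> j \<in> {1..k} \<and> i \<ge> j} \<union>
     {(fs i * (fx i + fx (i + 1)), (fx i + fx (i + 1)) * fs i) | i. i \<in> {1..<k}} \<union>
     {(fs i * (fy i + fy (i + 1)), (fy i + fy (i + 1)) * fs i) | i. i \<in> {1..<k}} \<union>
     {(fs i * fs (i + 1) * (fx (i + 1) - fs i * fx i * fs i) * fs (i + 1) * fs i,
       fx (i + 2) - fs (i + 1) * fx (i + 1) * fs (i + 1)) | i. 1 \<le> i \<and> i + 2 \<le> k} \<union>
     {(fs i * fs (i + 1) * (fy (i + 1) - fs i * fy i * fs i) * fs (i + 1) * fs i,
       fy (i + 2) - fs (i + 1) * fy (i + 1) * fs (i + 1)) | i. 1 \<le> i \<and> i + 2 \<le> k} \<union>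
     {(fx (i + 1) - fs i * fx i * fs i, fy (i + 1) - fs i * fy i * fs i) | i. i \<in> {1..<k}}"

definition dtb_algebra :: "nat \<Rightarrow> (complex, free_elt set) module" where
  "dtb_algebra k = presented_algebra (dtb_generators k) (dtb_relations k)"

text \<open>The image in the algebra of an element of the free algebra.\<close>

definition dtb_class :: "nat \<Rightarrow> free_elt \<Rightarrow> free_elt set" where
  "dtb_class k f =
     relation_ideal (dtb_generators k) (dtb_relations k)
       +>\<^bsub>free_algebra (dtb_generators k)\<^esub> f"

end

theory Submission
  imports Defs "HOL-Computational_Algebra.Fundamental_Theorem_Algebra"
begin

text \<open>For a set \<open>S\<close> of tensor factors let \<open>\<kappa>\<^sub>S\<close> be the Casimir operator of their tensor product.
  Invariance of the trace form makes \<open>\<kappa>\<^sub>S\<close> commute with the action of the Lie algebra on any set of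
  factors that contains \<open>S\<close> or is disjoint from it, hence with \<open>\<kappa>\<close> of any such set.  As \<open>x\<^sub>i\<close>, \<open>y\<^sub>i\<close>
  and \<open>z\<^sub>0 + \<dots> + z\<^sub>i\<close> are combinations of \<open>\<kappa>\<^sub>S\<close> for nested or disjoint \<open>S\<close> and of scalars, all
  commutation relations follow, and those with \<open>t\<^sub>w\<close> follow from \<open>t\<^sub>w \<kappa>\<^sub>S = \<kappa>\<^bsub>w(S)\<^esub> t\<^sub>w\<close>.
  The remaining relations are about \<open>m\<^bsub>i,j\<^esub>\<close>.  Expanding \<open>\<kappa>\<^sub>S\<close> into one- and two-factor terms gives
  \<open>x\<^sub>i = \<kappa>\<^sub>V / 2 + \<gamma>\<^bsub>M,i\<^esub> + (\<Sum>l<i. \<gamma>\<^bsub>l,i\<^esub>)\<close> and similarly for \<open>y\<^sub>i\<close>, because \<open>\<kappa>\<^sub>V\<close> is a scalar by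
  Schur's lemma.  Hence \<open>m\<^bsub>i,j\<^esub> = \<gamma>\<^bsub>i,j\<^esub>\<close>, whether computed from \<open>x\<close> or from \<open>y\<close>.\<close>

section \<open>Complex algebras\<close>

text \<open>The tensors of all degrees share one type, while the relations concern degree
  \<open>k\<close> alone. All computations therefore take place in the algebra of linear
  endomorphisms of the whole direct sum, where equalities of operators can be rewritten freely.
  Operators acting on a single factor are set to zero outside degree \<open>k\<close>: there the
  factor may be missing, and linearity in the Lie algebra element would break down. The permutations
  are instead the identity outside degree \<open>k\<close>, since the relation for the neutral
  permutation demands the unit of the algebra. As a consequence the Casimir operator of one copy of
  V is not a scalar but a scalar times the projection onto degree \<open>k\<close>. This is why the
  locale below contains an element \<open>C\<close> that is merely assumed to commute with the other
  operators. The relations are then consequences of bracket, commutation and permutation rules in an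
  arbitrary complex algebra; restriction to degree \<open>k\<close> and equivariance concern only
  the final passage to the endomorphism algebra. The symmetry of \<gamma> in its two tensor factors
  is used only to identify the image of \<open>z_0\<close> with \<gamma>.\<close>

class complex_algebra = complex_vector + ring + monoid_mult +
  assumes scaleC_mult_left: "(c *\<^sub>C x) * y = c *\<^sub>C (x * y)"
    and scaleC_mult_right: "x * (c *\<^sub>C y) = c *\<^sub>C (x * y)"

text \<open>As a type, the endomorphisms can be an instance of \<open>complex_algebra\<close>, so
  that the simplification rules for rings apply to operators. On the zero space the identity equals
  zero; hence \<open>complex_algebra\<close> is built on \<open>ring\<close> and
  \<open>monoid_mult\<close> and does not demand that 0 and 1 differ, as \<open>ring_1\<close>
  would.\<close>

typedef (overloaded) 'a endo = "{f :: 'a::complex_vector \<Rightarrow> 'a. clinear f}"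
  by (rule exI[of _ id]) (auto intro: clinearI)

setup_lifting type_definition_endo

lemma clinear_endo [simp]: "clinear (Rep_endo f)"
  using Rep_endo[of f] by simp

lemmas endo_add = clinear_add[OF clinear_endo]
  and endo_scale = clinear_scale[OF clinear_endo]
  and endo_zero = clinear_zero[OF clinear_endo]

instantiation endo :: (complex_vector) complex_algebra
begin

lift_definition zero_endo :: "'a endo" is "\<lambda>_. 0"
  by (rule clinearI) simp_all

lift_definition one_endo :: "'a endo" is "\<lambda>x. x"
  by (rule clinearI) simp_all

lift_definition plus_endo :: "'a endo \<Rightarrow> 'a endo \<Rightarrow> 'a endo" is "\<lambda>f g x. f x + g x"
  by (rule clinearI) (simp_all add: clinear_add clinear_scale cvec.scale_right_distrib)

lift_definition minus_endo :: "'a endo \<Rightarrow> 'a endo \<Rightarrow> 'a endo" is "\<lambda>f g x. f x - g x"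
  by (rule clinearI) (simp_all add: clinear_add clinear_scale cvec.scale_right_diff_distrib)

lift_definition uminus_endo :: "'a endo \<Rightarrow> 'a endo" is "\<lambda>f x. - f x"
  by (rule clinearI) (simp_all add: clinear_add clinear_scale)

lift_definition times_endo :: "'a endo \<Rightarrow> 'a endo \<Rightarrow> 'a endo" is "\<lambda>f g x. f (g x)"
  by (rule clinearI) (simp_all add: clinear_add clinear_scale)

lift_definition scaleC_endo :: "complex \<Rightarrow> 'a endo \<Rightarrow> 'a endo" is "\<lambda>c f x. c *\<^sub>C f x"
  by (rule clinearI) (simp_all add: clinear_add clinear_scale cvec.scale_right_distrib mult.commute)

instance
  by standard
    (transfer; simp add: fun_eq_iff clinear_add clinear_scale scaleC_add_right scaleC_add_left
      scaleC_scaleC scaleC_one)+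

end

lemmas endo_simps =
  zero_endo.rep_eq one_endo.rep_eq plus_endo.rep_eq minus_endo.rep_eq times_endo.rep_eq
  scaleC_endo.rep_eq

lemma Rep_endo_sum: "Rep_endo (\<Sum>i\<in>S. f i) x = (\<Sum>i\<in>S. Rep_endo (f i) x)"
  by (induction S rule: infinite_finite_induct) (simp_all add: endo_simps)

lemma endo_eqI: "(\<And>x. Rep_endo f x = Rep_endo g x) \<Longrightarrow> f = g"
  by (simp add: Rep_endo_inject[symmetric] fun_eq_iff)

section \<open>Evaluation of noncommutative polynomials: the extension of a map on letters to an
  algebra homomorphism\<close>

definition eval_poly ::
  "('a \<Rightarrow> 'e::complex_algebra) \<Rightarrow> ('a list \<Rightarrow>\<^sub>0 complex) \<Rightarrow> 'e" where
  "eval_poly \<phi> f =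
    (\<Sum>w\<in>Poly_Mapping.keys f. Poly_Mapping.lookup f w *\<^sub>C prod_list (map \<phi> w))"

lemma eval_poly_superset:
  assumes "finite S" "Poly_Mapping.keys f \<subseteq> S"
  shows "eval_poly \<phi> f = (\<Sum>w\<in>S. Poly_Mapping.lookup f w *\<^sub>C prod_list (map \<phi> w))"
  unfolding eval_poly_def using assms
  by (intro sum.mono_neutral_left) (auto simp: in_keys_iff)

lemma eval_poly_zero [simp]: "eval_poly \<phi> 0 = 0"
  by (simp add: eval_poly_def)

lemma eval_poly_single [simp]:
  "eval_poly \<phi> (Poly_Mapping.single w c) = c *\<^sub>C prod_list (map \<phi> w)"
  by (simp add: eval_poly_def)

lemma eval_poly_add [simp]: "eval_poly \<phi> (f + g) = eval_poly \<phi> f + eval_poly \<phi> g"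
  unfolding eval_poly_def
  by (rule setsum_keys_plus_distrib) (simp_all add: scaleC_add_left)

lemma eval_poly_scale [simp]: "eval_poly \<phi> (c *\<^sub>C f) = c *\<^sub>C eval_poly \<phi> f"
proof -
  have "Poly_Mapping.keys (c *\<^sub>C f) \<subseteq> Poly_Mapping.keys f"
    by (auto simp: in_keys_iff scaleC_poly_mapping.rep_eq)
  from eval_poly_superset[OF finite_keys this, of \<phi>] show ?thesis
    by (simp add: eval_poly_def scaleC_poly_mapping.rep_eq scaleC_complex_def
        cvec.scale_sum_right)
qed

lemma eval_poly_diff [simp]: "eval_poly \<phi> (f - g) = eval_poly \<phi> f - eval_poly \<phi> g"
  using eval_poly_add[of \<phi> "f - g" g] by (simp add: algebra_simps)

lemma eval_poly_sum [simp]: "eval_poly \<phi> (\<Sum>i\<in>S. f i) = (\<Sum>i\<in>S. eval_poly \<phi> (f i))"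
  by (induction S rule: infinite_finite_induct) simp_all

lemma eval_poly_one [simp]: "eval_poly \<phi> 1 = 1"
  by (simp flip: single_one add: zero_list_def)

text \<open>For words, \<open>0\<close> is the empty word and \<open>single 0 c\<close> the constant
  polynomial c. Turning scalars into ring elements gives the bilinearity of the product, and later
  the closure of ring ideals under scalars.\<close>

lemma scaleC_conv_single:
  fixes f :: "'a::monoid_add \<Rightarrow>\<^sub>0 complex"
  shows "c *\<^sub>C f = Poly_Mapping.single 0 c * f"
proof (induction f arbitrary: c rule: pretensor_induct)
  case (pure x)
  show ?case
    by (rule poly_mapping_eqI)
      (auto simp: mult_single scaleC_poly_mapping.rep_eq scaleC_complex_def lookup_single when_def)
next
  case (scale a f)
  have "c *\<^sub>C a *\<^sub>C f = (c * a) *\<^sub>C f"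
    by (simp add: scaleC_scaleC)
  also have "\<dots> = Poly_Mapping.single 0 c * (Poly_Mapping.single 0 a * f)"
    by (simp add: scale mult_single flip: mult.assoc)
  finally show ?case
    by (simp flip: scale)
qed (simp_all add: scaleC_add_right distrib_left)

lemma single_zero_commute:
  fixes f :: "'a::monoid_add \<Rightarrow>\<^sub>0 complex"
  shows "f * Poly_Mapping.single 0 c = Poly_Mapping.single 0 c * f"
proof (induction f rule: pretensor_induct)
  case (scale a f)
  have "Poly_Mapping.single 0 a * f * Poly_Mapping.single 0 c =
      Poly_Mapping.single 0 a * Poly_Mapping.single 0 c * f"
    by (simp add: scale mult.assoc)
  also have "\<dots> = Poly_Mapping.single 0 c * (Poly_Mapping.single 0 a * f)"
    by (simp add: mult_single mult.commute flip: mult.assoc)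
  finally show ?case
    by (simp add: scaleC_conv_single)
qed (simp_all add: mult_single distrib_left distrib_right)

lemma scaleC_poly_mult_left:
  fixes f g :: "'a::monoid_add \<Rightarrow>\<^sub>0 complex"
  shows "(c *\<^sub>C f) * g = c *\<^sub>C (f * g)"
  by (simp add: scaleC_conv_single mult.assoc)

lemma scaleC_poly_mult_right:
  fixes f g :: "'a::monoid_add \<Rightarrow>\<^sub>0 complex"
  shows "f * (c *\<^sub>C g) = c *\<^sub>C (f * g)"
  by (simp add: scaleC_conv_single single_zero_commute flip: mult.assoc)

lemma eval_poly_mult [simp]: "eval_poly \<phi> (f * g) = eval_poly \<phi> f * eval_poly \<phi> g"
proof (induction f rule: pretensor_induct)
  case (pure u)
  show ?case
  proof (induction g rule: pretensor_induct)
    case (pure v)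
    show ?case by (simp add: mult_single plus_list_def)
  next
    case (scale c g)
    then show ?case by (simp add: scaleC_poly_mult_right scaleC_mult_right)
  qed (simp_all add: distrib_left)
next
  case (scale c f)
  then show ?case by (simp add: scaleC_poly_mult_left scaleC_mult_left)
qed (simp_all add: distrib_right)

text \<open>The induced map is \<open>C \<mapsto> the_elem (h ` C)\<close>: as \<open>I\<close> lies in the kernel, the image of a coset
  under \<open>h\<close> is a singleton.\<close>

lemma quotient_algebra_universal:
  assumes I: "ideal I A"
    and h: "h \<in> algebra_hom A B" and B: "ring B"
    and scale: "\<And>c a. a \<in> carrier A \<Longrightarrow> c \<odot>\<^bsub>A\<^esub> a \<in> carrier A"
    and scale_I: "\<And>c a x. a \<in> carrier A \<Longrightarrow> x \<in> I \<Longrightarrow>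
      I +>\<^bsub>A\<^esub> (c \<odot>\<^bsub>A\<^esub> (x \<oplus>\<^bsub>A\<^esub> a)) = I +>\<^bsub>A\<^esub> (c \<odot>\<^bsub>A\<^esub> a)"
    and ker: "\<And>x. x \<in> I \<Longrightarrow> h x = \<zero>\<^bsub>B\<^esub>"
  shows "\<exists>\<Phi> \<in> algebra_hom (quotient_algebra A I) B. \<forall>a\<in>carrier A. \<Phi> (I +>\<^bsub>A\<^esub> a) = h a"
proof -
  interpret ideal I A by (rule I)
  interpret B: ring B by (rule B)
  have hr: "h \<in> ring_hom A B" and hs: "\<And>c a. a \<in> carrier A \<Longrightarrow> h (c \<odot>\<^bsub>A\<^esub> a) = c \<odot>\<^bsub>B\<^esub> h a"
    using h by (auto simp: algebra_hom_def)
  define \<Phi> where "\<Phi> C = the_elem (h ` C)" for C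
  have zero: "\<zero>\<^bsub>A\<^esub> \<in> I"
    by (rule additive_subgroup.zero_closed[OF additive_subgroup_axioms])
  have coset: "I +>\<^bsub>A\<^esub> a = {x \<oplus>\<^bsub>A\<^esub> a | x. x \<in> I}" for a
    by (auto simp: a_r_coset_def')
  have \<Phi>: "\<Phi> (I +>\<^bsub>A\<^esub> a) = h a" if "a \<in> carrier A" for a
  proof -
    have "h ` (I +>\<^bsub>A\<^esub> a) = {h a}"
    proof -
      have "h (x \<oplus>\<^bsub>A\<^esub> a) = h a" if "x \<in> I" for x
        using ring_hom_add[OF hr a_Hcarr[OF that] \<open>a \<in> carrier A\<close>] ker[OF that]
          ring_hom_closed[OF hr \<open>a \<in> carrier A\<close>] by simp
      then have "h ` (I +>\<^bsub>A\<^esub> a) \<subseteq> {h a}"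
        unfolding coset by auto
      moreover have "I +>\<^bsub>A\<^esub> a \<noteq> {}"
        unfolding coset using zero by blast
      ultimately show ?thesis
        by (metis image_is_empty subset_singletonD)
    qed
    then show ?thesis by (simp add: \<Phi>_def)
  qed
  have Q: "carrier (quotient_algebra A I) = {I +>\<^bsub>A\<^esub> a | a. a \<in> carrier A}"
    by (auto simp: quotient_algebra_def FactRing_def A_RCOSETS_def')
  have rh: "(+>\<^bsub>A\<^esub>) I \<in> ring_hom A (A Quot I)"
    by (rule rcos_ring_hom)
  \<comment> \<open>Scalar multiplication in the quotient is a union over all representatives of a
    coset. By \<open>scale_I\<close> all members of this union are the same coset, and the union is
    not empty because \<open>I\<close> contains zero.\<close>
  have smult: "c \<odot>\<^bsub>quotient_algebra A I\<^esub> (I +>\<^bsub>A\<^esub> a) = I +>\<^bsub>A\<^esub> (c \<odot>\<^bsub>A\<^esub> a)"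
    if "a \<in> carrier A" for c a
  proof -
    have "(\<Union>b\<in>I +>\<^bsub>A\<^esub> a. I +>\<^bsub>A\<^esub> (c \<odot>\<^bsub>A\<^esub> b)) = (\<Union>x\<in>I. I +>\<^bsub>A\<^esub> (c \<odot>\<^bsub>A\<^esub> (x \<oplus>\<^bsub>A\<^esub> a)))"
      unfolding coset[of a] by auto
    also have "\<dots> = (\<Union>x\<in>I. I +>\<^bsub>A\<^esub> (c \<odot>\<^bsub>A\<^esub> a))"
      using scale_I[OF that] by (intro SUP_cong) auto
    also have "\<dots> = I +>\<^bsub>A\<^esub> (c \<odot>\<^bsub>A\<^esub> a)"
      using UN_constant[of _ I] zero by (metis empty_iff)
    finally show ?thesis by (simp add: quotient_algebra_def)
  qed
  have "\<Phi> \<in> algebra_hom (quotient_algebra A I) B"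
    unfolding algebra_hom_def
  proof (intro CollectI conjI ballI allI ring_hom_memI)
    fix x y assume "x \<in> carrier (quotient_algebra A I)" "y \<in> carrier (quotient_algebra A I)"
    then obtain a a' where a: "a \<in> carrier A" "x = I +>\<^bsub>A\<^esub> a" "a' \<in> carrier A" "y = I +>\<^bsub>A\<^esub> a'"
      by (auto simp: Q)
    show "\<Phi> x \<in> carrier B"
      using a ring_hom_closed[OF hr] by (simp add: \<Phi>)
    have "x \<otimes>\<^bsub>A Quot I\<^esub> y = I +>\<^bsub>A\<^esub> (a \<otimes>\<^bsub>A\<^esub> a')"
      using ring_hom_mult[OF rh] a by simp
    then show "\<Phi> (x \<otimes>\<^bsub>quotient_algebra A I\<^esub> y) = \<Phi> x \<otimes>\<^bsub>B\<^esub> \<Phi> y"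
      using a ring_hom_mult[OF hr] by (simp add: \<Phi> quotient_algebra_def)
    have "x \<oplus>\<^bsub>A Quot I\<^esub> y = I +>\<^bsub>A\<^esub> (a \<oplus>\<^bsub>A\<^esub> a')"
      using ring_hom_add[OF rh] a by simp
    then show "\<Phi> (x \<oplus>\<^bsub>quotient_algebra A I\<^esub> y) = \<Phi> x \<oplus>\<^bsub>B\<^esub> \<Phi> y"
      using a ring_hom_add[OF hr] by (simp add: \<Phi> quotient_algebra_def)
    show "\<Phi> (c \<odot>\<^bsub>quotient_algebra A I\<^esub> x) = c \<odot>\<^bsub>B\<^esub> \<Phi> x" for c
      using a by (simp add: \<Phi> smult hs scale)
  next
    have "\<one>\<^bsub>A Quot I\<^esub> = I +>\<^bsub>A\<^esub> \<one>\<^bsub>A\<^esub>"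
      using ring_hom_one[OF rh] by simp
    then show "\<Phi> \<one>\<^bsub>quotient_algebra A I\<^esub> = \<one>\<^bsub>B\<^esub>"
      using ring_hom_one[OF hr] by (simp add: \<Phi> quotient_algebra_def)
  qed
  with \<Phi> show ?thesis by blast
qed

section \<open>The free algebra and the universal property of algebras given by generators and
  relations\<close>

lemma ring_free_algebra: "ring (free_algebra G)"
proof -
  have uminus: "Poly_Mapping.keys (- f) = Poly_Mapping.keys f" for f :: "'a list \<Rightarrow>\<^sub>0 complex"
    by (auto simp: in_keys_iff)
  have times: "Poly_Mapping.keys (f * g) \<subseteq> lists G"
    if "Poly_Mapping.keys f \<subseteq> lists G" "Poly_Mapping.keys g \<subseteq> lists G"
    for f g :: "'a list \<Rightarrow>\<^sub>0 complex"
    using keys_mult[of f g] that by (fastforce simp: plus_list_def)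
  show ?thesis
  proof (rule ringI)
    show "abelian_group (free_algebra G)"
    proof (rule abelian_groupI)
      fix x assume "x \<in> carrier (free_algebra G)"
      then show "\<exists>y\<in>carrier (free_algebra G). y \<oplus>\<^bsub>free_algebra G\<^esub> x = \<zero>\<^bsub>free_algebra G\<^esub>"
        by (intro bexI[of _ "- x"]) (auto simp: free_algebra_def uminus)
    qed (use keys_add in \<open>fastforce simp: free_algebra_def algebra_simps\<close>)+
    show "monoid (free_algebra G)"
      by (rule monoidI) (auto simp: free_algebra_def zero_list_def mult.assoc times)
  qed (auto simp: free_algebra_def distrib_left distrib_right)
qed

lemma single_in_free_algebra:
  "set w \<subseteq> G \<Longrightarrow> Poly_Mapping.single w c \<in> carrier (free_algebra G)"
  by (auto simp: free_algebra_def)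

lemma free_algebra_add:
  "f \<in> carrier (free_algebra G) \<Longrightarrow> g \<in> carrier (free_algebra G) \<Longrightarrow>
    f + g \<in> carrier (free_algebra G)"
  using keys_add[of f g] by (auto simp: free_algebra_def)

lemma free_algebra_diff:
  "f \<in> carrier (free_algebra G) \<Longrightarrow> g \<in> carrier (free_algebra G) \<Longrightarrow>
    f - g \<in> carrier (free_algebra G)"
  using keys_diff[of f g] by (auto simp: free_algebra_def)

lemma free_algebra_mult:
  "f \<in> carrier (free_algebra G) \<Longrightarrow> g \<in> carrier (free_algebra G) \<Longrightarrow>
    f * g \<in> carrier (free_algebra G)"
  using keys_mult[of f g] by (fastforce simp: free_algebra_def plus_list_def)

lemma free_algebra_scale:
  "f \<in> carrier (free_algebra G) \<Longrightarrow> c *\<^sub>C f \<in> carrier (free_algebra G)"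
  by (auto simp: free_algebra_def in_keys_iff scaleC_poly_mapping.rep_eq)

lemma free_algebra_one: "1 \<in> carrier (free_algebra G)"
  by (simp add: free_algebra_def zero_list_def)

lemma free_algebra_sum:
  "(\<And>i. i \<in> S \<Longrightarrow> f i \<in> carrier (free_algebra G)) \<Longrightarrow> sum f S \<in> carrier (free_algebra G)"
  by (induction S rule: infinite_finite_induct)
    (simp_all add: free_algebra_add, simp_all add: free_algebra_def)

text \<open>The kernel of \<open>h\<close> is an ideal containing every difference
  \<open>l - r\<close>, hence it contains the ideal generated by them, and \<open>h\<close> factors
  through the quotient.\<close>

lemma presented_algebra_universal:
  assumes B: "ring B" and h: "h \<in> algebra_hom (free_algebra G) B"
    and R: "\<And>l r. (l, r) \<in> R \<Longrightarrow>
      l \<in> carrier (free_algebra G) \<and> r \<in> carrier (free_algebra G) \<and> h l = h r"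
  shows "\<exists>\<Phi> \<in> algebra_hom (presented_algebra G R) B.
    \<forall>a\<in>carrier (free_algebra G). \<Phi> (relation_ideal G R +>\<^bsub>free_algebra G\<^esub> a) = h a"
proof -
  let ?A = "free_algebra G"
  have scale: "c \<odot>\<^bsub>?A\<^esub> a \<in> carrier ?A" if "a \<in> carrier ?A" for c a
    using free_algebra_scale[OF that] by (simp add: free_algebra_def)
  interpret A: ring ?A by (rule ring_free_algebra)
  interpret B: ring B by (rule B)
  have hr: "h \<in> ring_hom ?A B"
    using h by (auto simp: algebra_hom_def)
  interpret H: ring_hom_ring ?A B h
    by (rule ring_hom_ringI2[OF ring_free_algebra B hr])
  let ?S = "{l - r | l r. (l, r) \<in> R}" and ?I = "relation_ideal G R"
  have S: "?S \<subseteq> carrier ?A"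
    using R free_algebra_diff by blast
  then have I: "ideal ?I ?A"
    unfolding relation_ideal_def by (rule A.genideal_ideal)
  have "?S \<subseteq> a_kernel ?A B h"
  proof
    fix f assume "f \<in> ?S"
    then obtain l r where f: "f = l - r" "(l, r) \<in> R" by blast
    with R[OF f(2)] S have c: "f \<in> carrier ?A" "r \<in> carrier ?A" "h l = h r" by auto
    \<comment> \<open>The minus of the underlying type is not an operation that \<open>h\<close> is
      known to preserve. The difference \<open>f\<close> is therefore handled through
      \<open>l = f + r\<close> and cancellation in \<open>B\<close>.\<close>
    have "h l = h f \<oplus>\<^bsub>B\<^esub> h r"
      using H.hom_add[OF c(1,2)] f(1) by (simp add: free_algebra_def)
    then have "h f \<oplus>\<^bsub>B\<^esub> h r = \<zero>\<^bsub>B\<^esub> \<oplus>\<^bsub>B\<^esub> h r"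
      using c H.hom_closed[of r] by simp
    then have "h f = \<zero>\<^bsub>B\<^esub>"
      using H.hom_closed[OF c(2)] H.hom_closed[OF c(1)] B.zero_closed B.add.right_cancel[of "h r" "h f" "\<zero>\<^bsub>B\<^esub>"] by blast
    with c(1) show "f \<in> a_kernel ?A B h"
      unfolding a_kernel_def' by blast
  qed
  from A.genideal_minimal[OF H.kernel_is_ideal this]
  have "?I \<subseteq> a_kernel ?A B h"
    unfolding relation_ideal_def .
  then have ker: "\<And>x. x \<in> ?I \<Longrightarrow> h x = \<zero>\<^bsub>B\<^esub>"
    unfolding a_kernel_def' by blast
  interpret I: ideal ?I ?A by (rule I)
  have scale_I: "?I +>\<^bsub>?A\<^esub> (c \<odot>\<^bsub>?A\<^esub> (x \<oplus>\<^bsub>?A\<^esub> a)) = ?I +>\<^bsub>?A\<^esub> (c \<odot>\<^bsub>?A\<^esub> a)"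
    if a: "a \<in> carrier ?A" and x: "x \<in> ?I" for c a x
  proof -
    \<comment> \<open>An ideal is only required to absorb ring multiplication; it absorbs scalars
      because scaling is multiplication by a constant polynomial.\<close>
    have "Poly_Mapping.single 0 c \<in> carrier ?A"
      by (rule single_in_free_algebra) (simp add: zero_list_def)
    from I.I_l_closed[OF x this] have cx: "c *\<^sub>C x \<in> ?I"
      by (simp add: scaleC_conv_single free_algebra_def)
    have "c \<odot>\<^bsub>?A\<^esub> (x \<oplus>\<^bsub>?A\<^esub> a) = c *\<^sub>C x \<oplus>\<^bsub>?A\<^esub> c *\<^sub>C a"
      by (simp add: free_algebra_def scaleC_add_right)
    moreover have "?I +>\<^bsub>?A\<^esub> (c *\<^sub>C x \<oplus>\<^bsub>?A\<^esub> c *\<^sub>C a) = ?I +>\<^bsub>?A\<^esub> (c *\<^sub>C a)"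
      using I.a_repr_independence'[of "c *\<^sub>C x \<oplus>\<^bsub>?A\<^esub> c *\<^sub>C a" "c *\<^sub>C a"] cx a free_algebra_scale[OF a]
      by (force simp: a_r_coset_def')
    ultimately show ?thesis by (simp add: free_algebra_def)
  qed
  show ?thesis
    unfolding presented_algebra_def
    by (rule quotient_algebra_universal[OF I h B scale scale_I ker])
qed

section \<open>Casimir operators attached to sets of tensor factors\<close>

abbreviation (input) all_slots :: "nat \<Rightarrow> slot set" where
  "all_slots k \<equiv> {SlotM, SlotN} \<union> first_copies k"

primrec permute_slot :: "(nat \<Rightarrow> nat) \<Rightarrow> slot \<Rightarrow> slot" where
  "permute_slot w SlotM = SlotM"
| "permute_slot w SlotN = SlotN"
| "permute_slot w (SlotV j) = SlotV (w j)"

lemma SlotV_in_first_copies [simp]: "SlotV j \<in> first_copies i \<longleftrightarrow> 1 \<le> j \<and> j \<le> i"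
  and SlotM_notin_first_copies [simp]: "SlotM \<notin> first_copies i"
  and SlotN_notin_first_copies [simp]: "SlotN \<notin> first_copies i"
  by (auto simp: first_copies_def)

lemma finite_first_copies [simp]: "finite (first_copies i)"
  by (simp add: first_copies_def)

lemma first_copies_0 [simp]: "first_copies 0 = {}"
  by (simp add: first_copies_def)

lemma first_copies_step: "1 \<le> i \<Longrightarrow> first_copies i = insert (SlotV i) (first_copies (i - 1))"
proof -
  assume "1 \<le> i"
  then have "{1..i} = insert i {1..i - 1}" by auto
  then show ?thesis by (simp add: first_copies_def)
qed

lemma first_copies_mono: "i \<le> j \<Longrightarrow> first_copies i \<subseteq> first_copies j"
  by (auto simp: first_copies_def)

lemma inj_permute_slot: "w permutes S \<Longrightarrow> inj (permute_slot w)"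
proof (rule injI)
  fix p q assume "w permutes S" "permute_slot w p = permute_slot w q"
  then show "p = q"
    by (cases p; cases q) (auto dest: permutes_inj injD)
qed

lemma sref_permutes: "i \<in> {1..<k} \<Longrightarrow> sref i permutes {1..k}"
  unfolding sref_def by (rule permutes_swap_id) auto

lemma sref_simps [simp]:
  "sref i i = Suc i" "sref i (Suc i) = i" "j \<noteq> i \<Longrightarrow> j \<noteq> Suc i \<Longrightarrow> sref i j = j"
  by (auto simp: sref_def Transposition.transpose_def)

lemma sref_comp_sref [simp]: "sref i \<circ> sref i = id"
  by (auto simp: fun_eq_iff sref_def)

text \<open>The transposition exchanges positions i and i + 1. For \<open>j\<close> different from
  \<open>i\<close>, either both or neither of them are among the first \<open>j\<close>.\<close>

lemma permute_slot_sref_image: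
  assumes "1 \<le> i" "j \<noteq> i"
  shows "permute_slot (sref i) ` first_copies j = first_copies j"
proof -
  have "sref i ` {1..j} = {1..j}"
  proof (cases "i < j")
    case True
    with assms show ?thesis by (intro permutes_image sref_permutes) auto
  next
    case False
    with assms have "sref i l = l" if "l \<in> {1..j}" for l
      using that by auto
    then show ?thesis by simp
  qed
  then show ?thesis
    by (metis (no_types, lifting) first_copies_def image_cong image_image permute_slot.simps(3))
qed

text \<open>\<open>A p x\<close> is the action of \<open>x\<close> on the factor \<open>p\<close>, \<open>T w\<close> permutes the copies of \<open>V\<close> and \<open>C\<close>
  is the Casimir operator of a single copy of \<open>V\<close>.\<close>

locale casimir_operators =
  fixes k d :: nat and b b' :: "nat \<Rightarrow> 'g::complex_vector"
    and br :: "'g \<Rightarrow> 'g \<Rightarrow> 'g"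
    and A :: "slot \<Rightarrow> 'g \<Rightarrow> 'e::complex_algebra"
    and T :: "(nat \<Rightarrow> nat) \<Rightarrow> 'e" and C :: 'e
  assumes A_linear: "p \<in> all_slots k \<Longrightarrow> clinear (A p)"
    and A_bracket: "p \<in> all_slots k \<Longrightarrow> A p (br x y) = A p x * A p y - A p y * A p x"
    and A_commute: "p \<in> all_slots k \<Longrightarrow> q \<in> all_slots k \<Longrightarrow> p \<noteq> q \<Longrightarrow> A p x * A q y = A q y * A p x"
    and T_A: "w permutes {1..k} \<Longrightarrow> p \<in> all_slots k \<Longrightarrow>
      T w * A p x = A (permute_slot w p) x * T w"
    and T_comp: "w permutes {1..k} \<Longrightarrow> w' permutes {1..k} \<Longrightarrow> T w * T w' = T (w \<circ> w')"
    and T_id: "T id = 1"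
    and C_eq: "j \<in> {1..k} \<Longrightarrow> (\<Sum>i<d. A (SlotV j) (b i) * A (SlotV j) (b' i)) = C"
    and C_A: "p \<in> all_slots k \<Longrightarrow> C * A p x = A p x * C"
    and C_T: "w permutes {1..k} \<Longrightarrow> C * T w = T w * C"
    and invariant: "\<And>x. \<exists>r. \<forall>i<d. br x (b i) = (\<Sum>j<d. r i j *\<^sub>C b j) \<and>
      br x (b' i) = (\<Sum>j<d. - r j i *\<^sub>C b' j)"
begin

definition slots_op :: "slot set \<Rightarrow> 'g \<Rightarrow> 'e" where
  "slots_op S x = (\<Sum>p\<in>S. A p x)"

definition casimir :: "slot set \<Rightarrow> 'e" where
  "casimir S = (\<Sum>i<d. slots_op S (b i) * slots_op S (b' i))"

text \<open>In the notation of the paper, \<open>cross p q\<close> is \<open>2 \<gamma>\<^bsub>p,q\<^esub>\<close>, written symmetrically in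
  the two factors.\<close>

definition cross :: "slot \<Rightarrow> slot \<Rightarrow> 'e" where
  "cross p q = (\<Sum>i<d. A p (b i) * A q (b' i) + A q (b i) * A p (b' i))"

section \<open>Casimir operators commute with the Lie algebra, with each other and, up to
  relabelling, with permutations\<close>

lemma finite_slots: "S \<subseteq> all_slots k \<Longrightarrow> finite S"
  by (erule finite_subset) simp

lemma slots_op_linear:
  assumes "S \<subseteq> all_slots k"
  shows "clinear (slots_op S)"
proof (rule clinearI)
  have lin: "clinear (A p)" if "p \<in> S" for p
    using assms that A_linear by blast
  show "slots_op S (x + y) = slots_op S x + slots_op S y" for x y
    using clinear_add[OF lin] by (simp add: slots_op_def sum.distrib)
  show "slots_op S (c *\<^sub>C x) = c *\<^sub>C slots_op S x" for c x
    using clinear_scale[OF lin] by (simp add: slots_op_def cvec.scale_sum_right)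
qed

lemma slots_op_sum_scale:
  assumes "S \<subseteq> all_slots k"
  shows "slots_op S (\<Sum>j\<in>J. c j *\<^sub>C x j) = (\<Sum>j\<in>J. c j *\<^sub>C slots_op S (x j))"
  using slots_op_linear[OF assms]
  by (induction J rule: infinite_finite_induct)
    (simp_all add: clinear_add clinear_scale clinear_zero)

text \<open>In the double sum of commutators, actions on different factors commute; only the
  diagonal terms survive, and each of them is a bracket in one factor.\<close>

lemma slots_op_bracket:
  assumes "S \<subseteq> S'" "S' \<subseteq> all_slots k"
  shows "slots_op S' y * slots_op S x - slots_op S x * slots_op S' y = slots_op S (br y x)"
proof -
  have fin: "finite S" "finite S'"
    using assms finite_slots[of S'] finite_subset by auto
  have "slots_op S' y * slots_op S x - slots_op S x * slots_op S' y =
      (\<Sum>q\<in>S. \<Sum>p\<in>S'. A p y * A q x - A q x * A p y)"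
    unfolding slots_op_def sum_product sum_subtractf by (subst sum.swap) simp
  also have "\<dots> = (\<Sum>q\<in>S. \<Sum>p\<in>S'. if p = q then A q (br y x) else 0)"
  proof (intro sum.cong refl)
    fix q p assume "q \<in> S" "p \<in> S'"
    with assms have "p \<in> all_slots k" "q \<in> all_slots k" by blast+
    then show "A p y * A q x - A q x * A p y = (if p = q then A q (br y x) else 0)"
      using A_bracket A_commute by simp
  qed
  also have "\<dots> = slots_op S (br y x)"
    using assms fin by (auto simp: slots_op_def intro!: sum.cong)
  finally show ?thesis .
qed

lemma slots_op_commute:
  assumes "S \<inter> S' = {}" "S \<subseteq> all_slots k" "S' \<subseteq> all_slots k"
  shows "slots_op S' y * slots_op S x = slots_op S x * slots_op S' y"
proof -
  have "slots_op S' y * slots_op S x = (\<Sum>q\<in>S. \<Sum>p\<in>S'. A p y * A q x)"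
    unfolding slots_op_def sum_product by (rule sum.swap)
  also have "\<dots> = (\<Sum>q\<in>S. \<Sum>p\<in>S'. A q x * A p y)"
    using assms by (intro sum.cong refl A_commute) blast+
  also have "\<dots> = slots_op S x * slots_op S' y"
    unfolding slots_op_def sum_product ..
  finally show ?thesis .
qed

text \<open>The commutator with the action of \<open>y\<close> is a derivation, so it replaces each
  \<open>b i\<close> and each \<open>b' i\<close> in turn by its bracket with \<open>y\<close>. By
  \<open>invariant\<close> the two resulting coefficient matrices are negative transposes of each
  other, and the double sums cancel after exchanging the order of summation.\<close>

lemma casimir_act:
  assumes "S \<subseteq> S'" "S' \<subseteq> all_slots k"
  shows "slots_op S' y * casimir S = casimir S * slots_op S' y"
proof -
  have S: "S \<subseteq> all_slots k"
    using assms by blast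
  obtain r where r: "\<And>i. i < d \<Longrightarrow> br y (b i) = (\<Sum>j<d. r i j *\<^sub>C b j)"
    "\<And>i. i < d \<Longrightarrow> br y (b' i) = (\<Sum>j<d. - r j i *\<^sub>C b' j)"
    using invariant[of y] by blast
  have "slots_op S' y * casimir S - casimir S * slots_op S' y =
      (\<Sum>i<d. slots_op S' y * (slots_op S (b i) * slots_op S (b' i)) - slots_op S (b i) * slots_op S (b' i) * slots_op S' y)"
    by (simp add: casimir_def sum_distrib_left sum_distrib_right sum_subtractf)
  also have "\<dots> = (\<Sum>i<d. slots_op S (br y (b i)) * slots_op S (b' i) + slots_op S (b i) * slots_op S (br y (b' i)))"
    by (simp add: algebra_simps flip: slots_op_bracket[OF assms])
  also have "\<dots> = (\<Sum>i<d. \<Sum>j<d. r i j *\<^sub>C (slots_op S (b j) * slots_op S (b' i)))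
      - (\<Sum>i<d. \<Sum>j<d. r j i *\<^sub>C (slots_op S (b i) * slots_op S (b' j)))"
    by (simp add: r slots_op_sum_scale[OF S] sum_distrib_left sum_distrib_right
        scaleC_mult_left scaleC_mult_right sum_subtractf sum_negf
        module_hom.neg[OF clinear_module_hom[OF slots_op_linear[OF S]]])
  also have "\<dots> = 0"
    by (subst sum.swap) simp
  finally show ?thesis by simp
qed

lemma casimir_commute_act:
  assumes "S \<subseteq> S' \<or> S \<inter> S' = {}" "S \<subseteq> all_slots k" "S' \<subseteq> all_slots k"
  shows "slots_op S' y * casimir S = casimir S * slots_op S' y"
  using assms(1)
proof
  assume "S \<subseteq> S'"
  then show ?thesis using assms(3) by (rule casimir_act)
next
  assume "S \<inter> S' = {}"
  note c = slots_op_commute[OF this assms(2,3)]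
  have "slots_op S' y * (slots_op S x * slots_op S z) = slots_op S x * slots_op S z * slots_op S' y" for x z
    by (metis c mult.assoc)
  then show ?thesis
    by (simp add: casimir_def sum_distrib_left sum_distrib_right)
qed

lemma casimir_commute:
  assumes "S \<subseteq> S' \<or> S \<inter> S' = {}" "S \<subseteq> all_slots k" "S' \<subseteq> all_slots k"
  shows "casimir S * casimir S' = casimir S' * casimir S"
proof -
  note c = casimir_commute_act[OF assms]
  have "casimir S * (slots_op S' x * slots_op S' y) = slots_op S' x * slots_op S' y * casimir S" for x y
    by (metis c mult.assoc)
  then show ?thesis
    by (subst (2 3) casimir_def) (simp add: sum_distrib_left sum_distrib_right)
qed

lemma C_casimir:
  assumes "S \<subseteq> all_slots k"
  shows "C * casimir S = casimir S * C"
proof -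
  have c: "C * slots_op S x = slots_op S x * C" for x
    using assms C_A by (auto simp: slots_op_def sum_distrib_left sum_distrib_right intro!: sum.cong)
  have "C * (slots_op S x * slots_op S y) = slots_op S x * slots_op S y * C" for x y
    by (metis c mult.assoc)
  then show ?thesis
    by (simp add: casimir_def sum_distrib_left sum_distrib_right)
qed

lemma T_act:
  assumes "w permutes {1..k}" "S \<subseteq> all_slots k"
  shows "T w * slots_op S x = slots_op (permute_slot w ` S) x * T w"
proof -
  have "T w * slots_op S x = (\<Sum>p\<in>S. A (permute_slot w p) x * T w)"
    using assms T_A by (auto simp: slots_op_def sum_distrib_left intro!: sum.cong)
  also have "\<dots> = slots_op (permute_slot w ` S) x * T w"
    unfolding slots_op_def sum_distrib_right
    by (subst sum.reindex)
      (use inj_permute_slot[OF assms(1)] in \<open>auto intro: inj_on_subset\<close>)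
  finally show ?thesis .
qed

lemma T_casimir:
  assumes "w permutes {1..k}" "S \<subseteq> all_slots k"
  shows "T w * casimir S = casimir (permute_slot w ` S) * T w"
proof -
  have "T w * (slots_op S x * slots_op S y) =
      slots_op (permute_slot w ` S) x * slots_op (permute_slot w ` S) y * T w" for x y
    by (metis T_act[OF assms] mult.assoc)
  then show ?thesis
    by (simp add: casimir_def sum_distrib_left sum_distrib_right)
qed

lemma T_cross:
  assumes w: "w permutes {1..k}" and p: "p \<in> all_slots k" and q: "q \<in> all_slots k"
  shows "T w * cross p q = cross (permute_slot w p) (permute_slot w q) * T w"
proof -
  have "T w * (A p x * A q y) = A (permute_slot w p) x * A (permute_slot w q) y * T w"
    if "p \<in> all_slots k" "q \<in> all_slots k" for x y p q
    by (metis T_A[OF w] that mult.assoc)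
  with p q show ?thesis
    by (simp add: cross_def sum_distrib_left sum_distrib_right distrib_left distrib_right)
qed

text \<open>This is the formula for the Casimir element on a tensor product. Multiplying out gives
  the mixed terms in both orders, which is the reason for the two summands in
  \<open>cross\<close>.\<close>

lemma casimir_insert:
  assumes "q \<notin> S" "finite S"
  shows "casimir (insert q S) = casimir S + casimir {q} + (\<Sum>p\<in>S. cross p q)"
proof -
  have "(\<Sum>p\<in>S. cross p q) =
      (\<Sum>i<d. slots_op S (b i) * A q (b' i) + A q (b i) * slots_op S (b' i))"
    unfolding cross_def slots_op_def sum_distrib_left sum_distrib_right
    by (subst sum.swap) (simp add: sum.distrib)
  then show ?thesis
    using assms by (simp add: casimir_def slots_op_def algebra_simps sum.distrib)
qed

lemma casimir_SlotV: "j \<in> {1..k} \<Longrightarrow> casimir {SlotV j} = C"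
  using C_eq by (simp add: casimir_def slots_op_def)

section \<open>Images of the generators; x, y and z are treated uniformly through the set
  \<open>E\<close> of boundary factors\<close>

definition boundary_op :: "slot set \<Rightarrow> nat \<Rightarrow> 'e" where
  "boundary_op E i =
    (1/2) *\<^sub>C (casimir (E \<union> first_copies i) - casimir (E \<union> first_copies (i - 1)))"

definition z_op :: "nat \<Rightarrow> 'e" where
  "z_op i = (if i = 0 then (1/2) *\<^sub>C (casimir {SlotM, SlotN} - casimir {SlotM} - casimir {SlotN})
    else boundary_op {SlotM, SlotN} i + (1/2) *\<^sub>C C)"

primrec gen_op :: "gen \<Rightarrow> 'e" where
  "gen_op (GenT w) = T w"
| "gen_op (GenX i) = boundary_op {SlotM} i"
| "gen_op (GenY i) = boundary_op {SlotN} i"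
| "gen_op (GenZ i) = z_op i"

lemma eval_gens [simp]:
  "eval_poly gen_op (ft w) = T w"
  "eval_poly gen_op (fx i) = boundary_op {SlotM} i"
  "eval_poly gen_op (fy i) = boundary_op {SlotN} i"
  "eval_poly gen_op (fz i) = z_op i"
  by (simp_all add: ft_def fx_def fy_def fz_def scaleC_one)

lemma boundary_op_cross:
  assumes "E \<subseteq> {SlotM, SlotN}" "i \<in> {1..k}"
  shows "boundary_op E i =
    (1/2) *\<^sub>C (C + (\<Sum>e\<in>E. cross e (SlotV i)) + (\<Sum>l\<in>{1..<i}. cross (SlotV l) (SlotV i)))"
proof -
  have fin: "finite E"
    using assms(1) by (rule finite_subset) simp
  have notin: "SlotV i \<notin> E \<union> first_copies (i - 1)"
    using assms by auto
  have "casimir (E \<union> first_copies i) = casimir (insert (SlotV i) (E \<union> first_copies (i - 1)))"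
    using assms by (subst first_copies_step) auto
  also have "\<dots> = casimir (E \<union> first_copies (i - 1)) + C
      + (\<Sum>p\<in>E \<union> first_copies (i - 1). cross p (SlotV i))"
    using casimir_insert[OF notin] fin casimir_SlotV[OF assms(2)] by simp
  also have "(\<Sum>p\<in>E \<union> first_copies (i - 1). cross p (SlotV i)) =
      (\<Sum>e\<in>E. cross e (SlotV i)) + (\<Sum>p\<in>first_copies (i - 1). cross p (SlotV i))"
    using fin assms(1) by (intro sum.union_disjoint) auto
  also have "(\<Sum>p\<in>first_copies (i - 1). cross p (SlotV i)) =
      (\<Sum>l\<in>{1..<i}. cross (SlotV l) (SlotV i))"
  proof -
    have "first_copies (i - 1) = SlotV ` {1..<i}"
      using assms(2) by (auto simp: first_copies_def)
    then show ?thesis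
      by (simp add: sum.reindex inj_on_def)
  qed
  finally show ?thesis
    by (simp add: boundary_op_def algebra_simps)
qed

lemma T_sref_sref: "i \<in> {1..<k} \<Longrightarrow> T (sref i) * T (sref i) = 1"
  using T_comp[OF sref_permutes sref_permutes] by (simp add: T_id)

text \<open>Conjugation by the transposition turns the cross terms of copy i into those of copy i +
  1 and fixes the boundary factors and the copies before i. The only term of
  \<open>boundary_op E (i + 1)\<close> left over is the one between the two exchanged copies, and it
  does not involve \<open>E\<close>.\<close>

lemma boundary_op_difference:
  assumes "E \<subseteq> {SlotM, SlotN}" "i \<in> {1..<k}"
  shows "boundary_op E (i + 1) - T (sref i) * boundary_op E i * T (sref i) =
    (1/2) *\<^sub>C cross (SlotV i) (SlotV (i + 1))"
proof -
  let ?T = "T (sref i)"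
  let ?R = "C + (\<Sum>e\<in>E. cross e (SlotV (i + 1))) + (\<Sum>l\<in>{1..<i}. cross (SlotV l) (SlotV (i + 1)))"
  have w: "sref i permutes {1..k}"
    using assms(2) by (rule sref_permutes)
  have "?T * cross e (SlotV i) = cross e (SlotV (i + 1)) * ?T" if "e \<in> E" for e
    using that assms T_cross[OF w, of e "SlotV i"] by auto
  moreover have "?T * cross (SlotV l) (SlotV i) = cross (SlotV l) (SlotV (i + 1)) * ?T"
    if "l \<in> {1..<i}" for l
    using that assms T_cross[OF w, of "SlotV l" "SlotV i"] by auto
  ultimately have "?T * (C + (\<Sum>e\<in>E. cross e (SlotV i)) + (\<Sum>l\<in>{1..<i}. cross (SlotV l) (SlotV i)))
      = ?R * ?T"
    using C_T[OF w] by (simp add: distrib_left distrib_right sum_distrib_left sum_distrib_right)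
  then have "?T * boundary_op E i = (1/2) *\<^sub>C (?R * ?T)"
    using assms by (simp add: boundary_op_cross scaleC_mult_right)
  then have "?T * boundary_op E i * ?T = (1/2) *\<^sub>C ?R"
    using T_sref_sref[OF assms(2)] by (simp add: scaleC_mult_left mult.assoc)
  moreover have "boundary_op E (i + 1) = (1/2) *\<^sub>C (?R + cross (SlotV i) (SlotV (i + 1)))"
    using assms by (subst boundary_op_cross) (auto simp: algebra_simps)
  ultimately show ?thesis
    by (simp add: algebra_simps)
qed

text \<open>The adjacent case is \<open>boundary_op_difference\<close>. Conjugation by the
  transposition of i and j - 1 carries it to the pair (i, j), because this transposition fixes
  j.\<close>

lemma eval_fm:
  assumes "j \<in> {1..k}"
  shows "eval_poly gen_op (fm j) = (1/2) *\<^sub>C (\<Sum>i\<in>{1..<j}. cross (SlotV i) (SlotV j))"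
proof -
  have "eval_poly gen_op (fm_pair i j) = (1/2) *\<^sub>C cross (SlotV i) (SlotV j)" if i: "i \<in> {1..<j}" for i
  proof -
    let ?t = "Transposition.transpose i (j - 1)"
    have D: "boundary_op {SlotM} j - T (sref (j - 1)) * boundary_op {SlotM} (j - 1) * T (sref (j - 1)) =
        (1/2) *\<^sub>C cross (SlotV (j - 1)) (SlotV j)"
    proof -
      have "j - 1 \<in> {1..<k}" "j - 1 + 1 = j"
        using assms i by auto
      with boundary_op_difference[of "{SlotM}" "j - 1"] show ?thesis by simp
    qed
    show ?thesis
    proof (cases "i = j - 1")
      case True
      with D show ?thesis
        by (simp add: fm_pair_def Let_def)
    next
      case False
      have w: "?t permutes {1..k}"
        using assms i by (intro permutes_swap_id) auto
      have "T ?t * cross (SlotV (j - 1)) (SlotV j) = cross (SlotV i) (SlotV j) * T ?t"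
        proof -
        have "1 \<le> j - 1" "j - 1 \<le> k" "j \<noteq> j - 1" "j \<noteq> i"
          using assms i False by auto
        then show ?thesis
          using T_cross[OF w, of "SlotV (j - 1)" "SlotV j"] assms
          by (auto simp: Transposition.transpose_def)
      qed
      moreover have "T ?t * T ?t = 1"
        using T_comp[OF w w] by (simp add: T_id)
      ultimately have "T ?t * ((1/2) *\<^sub>C cross (SlotV (j - 1)) (SlotV j)) * T ?t =
          (1/2) *\<^sub>C cross (SlotV i) (SlotV j)"
        by (simp add: scaleC_mult_right scaleC_mult_left mult.assoc)
      with False D show ?thesis
        by (simp add: fm_pair_def Let_def)
    qed
  qed
  then show ?thesis
    by (simp add: fm_def cvec.scale_sum_right)
qed

text \<open>Here the extra \<open>(1/2) *\<^sub>C C\<close> in \<open>z_op\<close> is accounted for: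
  the images of \<open>x_i\<close> and \<open>y_i\<close> contain half of \<open>C\<close> each,
  whereas \<open>boundary_op {SlotM, SlotN} i\<close> contains only one half. The cross terms with
  earlier copies occur in both images, once too often, and are subtracted.\<close>

lemma z_op_eq:
  assumes "i \<in> {1..k}"
  shows "z_op i = boundary_op {SlotM} i + boundary_op {SlotN} i
    - (1/2) *\<^sub>C (\<Sum>l\<in>{1..<i}. cross (SlotV l) (SlotV i))"
  using assms by (simp add: z_op_def boundary_op_cross algebra_simps)

section \<open>Commutation relations between the images of the generators\<close>

lemma boundary_op_commute:
  assumes "E \<subseteq> {SlotM, SlotN}" "i \<le> k" "j \<le> k"
  shows "boundary_op E i * boundary_op E j = boundary_op E j * boundary_op E i"
proof -
  have "casimir (E \<union> first_copies i) * casimir (E \<union> first_copies j) =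
      casimir (E \<union> first_copies j) * casimir (E \<union> first_copies i)" if "i \<le> k" "j \<le> k" for i j
  proof -
    have "E \<union> first_copies i \<subseteq> all_slots k" "E \<union> first_copies j \<subseteq> all_slots k"
      using that assms(1) first_copies_mono by blast+
    moreover have "E \<union> first_copies i \<subseteq> E \<union> first_copies j \<or> E \<union> first_copies j \<subseteq> E \<union> first_copies i"
      using first_copies_mono[of i j] first_copies_mono[of j i] by (meson Un_mono linear order_refl)
    ultimately show ?thesis
      using casimir_commute by metis
  qed
  from this[of i j] this[of "i - 1" j] this[of i "j - 1"] this[of "i - 1" "j - 1"] assms
  show ?thesis
    by (simp add: boundary_op_def scaleC_mult_left scaleC_mult_right algebra_simps)
qed

lemma T_sref_casimir:
  assumes "E \<subseteq> {SlotM, SlotN}" "i \<in> {1..<k}" "j \<le> k" "j \<noteq> i"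
  shows "T (sref i) * casimir (E \<union> first_copies j) = casimir (E \<union> first_copies j) * T (sref i)"
proof -
  have "permute_slot (sref i) ` E = E"
    using assms(1) by force
  moreover have "permute_slot (sref i) ` first_copies j = first_copies j"
    using assms by (intro permute_slot_sref_image) auto
  moreover have "E \<union> first_copies j \<subseteq> all_slots k"
    using assms first_copies_mono[of j k] by blast
  ultimately show ?thesis
    using T_casimir[OF sref_permutes[OF assms(2)], of "E \<union> first_copies j"] by (simp add: image_Un)
qed

text \<open>\<open>boundary_op E j\<close> involves the first j and the first j - 1 copies. The
  transposition preserves both sets unless \<open>i\<close> is j or j - 1, which are the two
  excluded cases.\<close>

lemma T_boundary_op:
  assumes "E \<subseteq> {SlotM, SlotN}" "i \<in> {1..<k}" "j \<in> {1..k}" "j \<noteq> i" "j \<noteq> i + 1"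
  shows "T (sref i) * boundary_op E j = boundary_op E j * T (sref i)"
  using T_sref_casimir[of E i j] T_sref_casimir[of E i "j - 1"] assms
  by (auto simp: boundary_op_def scaleC_mult_left scaleC_mult_right algebra_simps)

text \<open>In the sum the Casimir operator for the first i copies cancels, and it is the one that
  the transposition does not preserve.\<close>

lemma T_boundary_op_sum:
  assumes "E \<subseteq> {SlotM, SlotN}" "i \<in> {1..<k}"
  shows "T (sref i) * (boundary_op E i + boundary_op E (i + 1)) =
    (boundary_op E i + boundary_op E (i + 1)) * T (sref i)"
proof -
  have "boundary_op E i + boundary_op E (i + 1) =
      (1/2) *\<^sub>C (casimir (E \<union> first_copies (i + 1)) - casimir (E \<union> first_copies (i - 1)))"
    by (simp add: boundary_op_def algebra_simps)
  show ?thesis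
    unfolding \<open>boundary_op E i + boundary_op E (i + 1) = _\<close> using T_sref_casimir[of E i "i + 1"] T_sref_casimir[of E i "i - 1"] assms
    by (auto simp: scaleC_mult_left scaleC_mult_right algebra_simps)
qed

lemma T_z_op:
  assumes "i \<in> {1..<k}" "j \<le> k" "j \<noteq> i" "j \<noteq> i + 1"
  shows "T (sref i) * z_op j = z_op j * T (sref i)"
proof (cases "j = 0")
  case True
  then show ?thesis
    using T_sref_casimir[of "{SlotM, SlotN}" i 0] T_sref_casimir[of "{SlotM}" i 0]
      T_sref_casimir[of "{SlotN}" i 0] assms
    by (simp add: z_op_def scaleC_mult_left scaleC_mult_right algebra_simps)
next
  case False
  then show ?thesis
    using T_boundary_op[of "{SlotM, SlotN}" i j] C_T[OF sref_permutes[OF assms(1)]] assms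
    by (simp add: z_op_def scaleC_mult_left scaleC_mult_right algebra_simps)
qed

lemma boundary_op_C:
  assumes "E \<subseteq> {SlotM, SlotN}" "i \<le> k"
  shows "C * boundary_op E i = boundary_op E i * C"
proof -
  have "E \<union> first_copies i \<subseteq> all_slots k" "E \<union> first_copies (i - 1) \<subseteq> all_slots k"
    using assms first_copies_mono[of i k] first_copies_mono[of "i - 1" k] le_trans[OF diff_le_self assms(2)]
    by blast+
  from this[THEN C_casimir] show ?thesis
    by (simp add: boundary_op_def scaleC_mult_left scaleC_mult_right algebra_simps)
qed

lemma casimir_ends_commute:
  assumes "E \<subseteq> {SlotM, SlotN}" "i \<le> k" "E' \<in> {{SlotM}, {SlotN}, {SlotM, SlotN}}"
    "E' \<subseteq> E \<or> E \<inter> E' = {}"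
  shows "casimir E' * casimir (E \<union> first_copies i) = casimir (E \<union> first_copies i) * casimir E'"
proof (rule casimir_commute)
  show "E' \<subseteq> E \<union> first_copies i \<or> E' \<inter> (E \<union> first_copies i) = {}"
    using assms(3,4) by auto
  show "E \<union> first_copies i \<subseteq> all_slots k"
    using assms first_copies_mono[of i k] by blast
qed (use assms in auto)

lemma z_op_0_boundary_op:
  assumes "i \<le> k"
  shows "z_op 0 * boundary_op {SlotM, SlotN} i = boundary_op {SlotM, SlotN} i * z_op 0"
proof -
  let ?E = "{SlotM, SlotN}"
  have "casimir E' * casimir (?E \<union> first_copies j) = casimir (?E \<union> first_copies j) * casimir E'"
    if "E' \<in> {{SlotM}, {SlotN}, ?E}" "j \<le> k" for E' j
    using that by (intro casimir_ends_commute) auto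
  from this[of _ i] this[of _ "i - 1"] assms show ?thesis
    by (simp add: boundary_op_def z_op_def scaleC_mult_left scaleC_mult_right algebra_simps)
qed

lemma z_op_commute:
  assumes "i \<le> k" "j \<le> k"
  shows "z_op i * z_op j = z_op j * z_op i"
proof -
  let ?E = "{SlotM, SlotN}"
  have C0: "C * z_op 0 = z_op 0 * C"
    using C_casimir[of ?E] C_casimir[of "{SlotM}"] C_casimir[of "{SlotN}"]
    by (simp add: z_op_def scaleC_mult_left scaleC_mult_right algebra_simps)
  have z: "z_op i = boundary_op ?E i + (1/2) *\<^sub>C C" if "i \<noteq> 0" for i
    using that by (simp add: z_op_def)
  note c = scaleC_mult_left scaleC_mult_right algebra_simps
    boundary_op_C[of ?E i] boundary_op_C[of ?E j] boundary_op_commute[of ?E i j]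
    z_op_0_boundary_op[of i] z_op_0_boundary_op[of j] C0
  show ?thesis
    using assms by (cases "i = 0"; cases "j = 0") (simp_all add: c z)
qed

text \<open>The sum telescopes, starting from the Casimir operator of \<open>{SlotM, SlotN}\<close>
  in \<open>z_op 0\<close>; each later term adds another half of \<open>C\<close>.\<close>

lemma sum_z_op:
  assumes "i \<le> k"
  shows "(\<Sum>l\<in>{0..i}. z_op l) = (1/2) *\<^sub>C (casimir ({SlotM, SlotN} \<union> first_copies i)
    - casimir {SlotM} - casimir {SlotN} + of_nat i *\<^sub>C C)"
proof (induction i)
  case 0
  then show ?case by (simp add: z_op_def)
next
  case (Suc i)
  then show ?case
    by (simp add: z_op_def boundary_op_def algebra_simps)
qed

text \<open>The condition \<open>j \<le> i\<close> makes \<open>E\<close> together with the first j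
  copies a subset of both boundary factors together with the first i copies. The Casimir operators
  of single boundary factors, also present in the sum, belong to sets contained in or disjoint from
  those occurring in \<open>boundary_op E j\<close>.\<close>

lemma sum_z_op_boundary_op:
  assumes "E \<in> {{SlotM}, {SlotN}}" "i \<le> k" "j \<le> i"
  shows "(\<Sum>l\<in>{0..i}. z_op l) * boundary_op E j = boundary_op E j * (\<Sum>l\<in>{0..i}. z_op l)"
proof -
  let ?Z = "\<Sum>l\<in>{0..i}. z_op l"
  have "?Z * casimir (E \<union> first_copies j) = casimir (E \<union> first_copies j) * ?Z" if j: "j \<le> i" for j
  proof -
    have sub: "E \<union> first_copies j \<subseteq> all_slots k"
      using assms(1,2) j first_copies_mono[of j k] by auto
    have "casimir (E \<union> first_copies j) * casimir ({SlotM, SlotN} \<union> first_copies i) =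
        casimir ({SlotM, SlotN} \<union> first_copies i) * casimir (E \<union> first_copies j)"
      using assms sub first_copies_mono[OF j] first_copies_mono[of i k]
      by (intro casimir_commute) auto
    moreover have "casimir E' * casimir (E \<union> first_copies j) = casimir (E \<union> first_copies j) * casimir E'"
      if "E' \<in> {{SlotM}, {SlotN}}" for E'
      using that assms j by (intro casimir_ends_commute) auto
    ultimately show ?thesis
      using C_casimir[OF sub]
      by (simp add: sum_z_op assms(2) scaleC_mult_left scaleC_mult_right algebra_simps)
  qed
  from this[of j] this[of "j - 1"] assms show ?thesis
    by (simp add: boundary_op_def scaleC_mult_left scaleC_mult_right algebra_simps)
qed

text \<open>By \<open>boundary_op_difference\<close> both sides are cross terms of adjacent copies.
  The pair (i, i + 1) is carried to (i, i + 2) by the second transposition and then to (i + 1, i +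
  2) by the first one; the two factors on the right form the inverse of this permutation.\<close>

lemma boundary_op_braid:
  assumes E: "E \<subseteq> {SlotM, SlotN}" and i: "1 \<le> i" "i + 2 \<le> k"
  shows "T (sref i) * T (sref (i + 1)) * (boundary_op E (i + 1) - T (sref i) * boundary_op E i * T (sref i))
      * T (sref (i + 1)) * T (sref i) =
    boundary_op E (i + 2) - T (sref (i + 1)) * boundary_op E (i + 1) * T (sref (i + 1))"
proof -
  let ?s = "T (sref i)" and ?s' = "T (sref (i + 1))"
  have w: "sref i permutes {1..k}" "sref (i + 1) permutes {1..k}"
    by (rule sref_permutes, use i in simp)+
  have "?s' * cross (SlotV i) (SlotV (i + 1)) = cross (SlotV i) (SlotV (i + 2)) * ?s'"
    using T_cross[OF w(2), of "SlotV i" "SlotV (i + 1)"] i by (simp add: eval_nat_numeral)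
  then have "?s * ?s' * cross (SlotV i) (SlotV (i + 1)) = cross (SlotV (i + 1)) (SlotV (i + 2)) * ?s * ?s'"
    using T_cross[OF w(1), of "SlotV i" "SlotV (i + 2)"] i by (simp add: mult.assoc) (simp flip: mult.assoc)
  then have "?s * ?s' * cross (SlotV i) (SlotV (i + 1)) * ?s' * ?s =
      cross (SlotV (i + 1)) (SlotV (i + 2)) * (?s * (?s' * ?s') * ?s)"
    by (simp add: mult.assoc)
  also have "?s * (?s' * ?s') * ?s = 1"
    using T_sref_sref[of i] T_sref_sref[of "i + 1"] i by simp
  finally show ?thesis
    using boundary_op_difference[OF E, of i] boundary_op_difference[OF E, of "i + 1"] i
    by (simp add: scaleC_mult_left scaleC_mult_right)
qed

text \<open>Serves two choices of \<open>X\<close>: the action of the Lie algebra on all factors,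
  which gives equivariance, and the projection onto degree \<open>k\<close>, which shows that this
  degree is preserved.\<close>

lemma gen_op_commute:
  assumes X: "\<And>S. S \<subseteq> all_slots k \<Longrightarrow> X * casimir S = casimir S * X"
    "\<And>w. w permutes {1..k} \<Longrightarrow> X * T w = T w * X" "X * C = C * X"
    and g: "g \<in> dtb_generators k"
  shows "X * gen_op g = gen_op g * X"
proof -
  have boundary: "X * boundary_op E i = boundary_op E i * X" if "E \<subseteq> {SlotM, SlotN}" "i \<le> k" for E i
  proof -
    have "E \<union> first_copies i \<subseteq> all_slots k" "E \<union> first_copies (i - 1) \<subseteq> all_slots k"
      using that first_copies_mono[of i k] first_copies_mono[of "i - 1" k] le_trans[OF diff_le_self that(2)]
      by blast+
    from this[THEN X(1)] show ?thesis
      by (simp add: boundary_op_def scaleC_mult_left scaleC_mult_right algebra_simps)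
  qed
  have "X * z_op i = z_op i * X" if "i \<le> k" for i
    using boundary[of "{SlotM, SlotN}" i] that X(1)[of "{SlotM, SlotN}"] X(1)[of "{SlotM}"]
      X(1)[of "{SlotN}"] X(3)
    by (simp add: z_op_def scaleC_mult_left scaleC_mult_right algebra_simps)
  with g boundary X(2) show ?thesis
    by (auto simp: dtb_generators_def)
qed

lemma gen_op_act:
  assumes "g \<in> dtb_generators k"
  shows "slots_op (all_slots k) x * gen_op g = gen_op g * slots_op (all_slots k) x"
proof (rule gen_op_commute)
  show "slots_op (all_slots k) x * casimir S = casimir S * slots_op (all_slots k) x" if "S \<subseteq> all_slots k" for S
    using that by (rule casimir_act) simp
  show "slots_op (all_slots k) x * T w = T w * slots_op (all_slots k) x" if w: "w permutes {1..k}" for w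
  proof -
    have "permute_slot w ` first_copies k = SlotV ` w ` {1..k}"
      by (simp add: first_copies_def image_image)
    also have "\<dots> = first_copies k"
      by (simp only: permutes_image[OF w] first_copies_def)
    finally show ?thesis
      using T_act[OF w order_refl, of x] by (simp add: image_Un)
  qed
  show "slots_op (all_slots k) x * C = C * slots_op (all_slots k) x"
    unfolding slots_op_def sum_distrib_left sum_distrib_right
    by (rule sum.cong[OF refl]) (rule C_A[symmetric])
qed (rule assms)

text \<open>The sixteen families are treated one by one, in the order in which they appear in
  \<open>dtb_relations\<close>.\<close>

lemma relations_hold: "\<forall>p\<in>dtb_relations k. eval_poly gen_op (fst p) = eval_poly gen_op (snd p)"
  unfolding dtb_relations_def ball_Un
  apply (intro conjI ballI; elim CollectE exE conjE insertE emptyE; hypsubst;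
    simp only: fst_conv snd_conv eval_poly_mult eval_poly_add eval_poly_diff eval_poly_sum
      eval_poly_one eval_gens)
                 apply (simp add: z_op_eq eval_fm)
                apply (rule T_comp; assumption)
               apply (rule T_id)
              apply (rule boundary_op_commute; simp)
             apply (rule boundary_op_commute; simp)
            apply (rule z_op_commute; simp)
           apply (rule T_boundary_op; simp)
          apply (rule T_boundary_op; simp)
         apply (rule T_z_op; simp)
        apply (rule sum_z_op_boundary_op; simp)
       apply (rule sum_z_op_boundary_op; simp)
      apply (rule T_boundary_op_sum; simp)
     apply (rule T_boundary_op_sum; simp)
    apply (rule boundary_op_braid; simp)
   apply (rule boundary_op_braid; simp)
  \<comment> \<open>The value given by \<open>boundary_op_difference\<close> is independent of
    \<open>E\<close>, so x and y yield the same difference.\<close>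
  apply (subst (1 2) boundary_op_difference; simp)
  done

end

section \<open>The generators and relations in the free algebra\<close>

lemma generators_in_free_algebra:
  shows "w permutes {1..k} \<Longrightarrow> ft w \<in> carrier (free_algebra (dtb_generators k))"
    and "i \<in> {1..k} \<Longrightarrow> fx i \<in> carrier (free_algebra (dtb_generators k))"
    and "i \<in> {1..k} \<Longrightarrow> fy i \<in> carrier (free_algebra (dtb_generators k))"
    and "i \<in> {0..k} \<Longrightarrow> fz i \<in> carrier (free_algebra (dtb_generators k))"
  by (auto simp: ft_def fx_def fy_def fz_def dtb_generators_def intro!: single_in_free_algebra)

lemma fm_in_free_algebra:
  assumes "j \<in> {1..k}"
  shows "fm j \<in> carrier (free_algebra (dtb_generators k))"
  unfolding fm_def
proof (rule free_algebra_sum)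
  fix i assume i: "i \<in> {1..<j}"
  have "Transposition.transpose i (j - 1) permutes {1..k}"
    using assms i by (intro permutes_swap_id) auto
  moreover have "j - 1 \<in> {1..k}" "sref (j - 1) permutes {1..k}"
    using assms i by (auto intro!: sref_permutes simp del: One_nat_def)
  ultimately show "fm_pair i j \<in> carrier (free_algebra (dtb_generators k))"
    using assms by (auto simp: fm_pair_def Let_def simp del: One_nat_def
        intro!: free_algebra_mult free_algebra_diff generators_in_free_algebra)
qed

lemma relations_in_free_algebra:
  "\<forall>p\<in>dtb_relations k. fst p \<in> carrier (free_algebra (dtb_generators k)) \<and>
    snd p \<in> carrier (free_algebra (dtb_generators k))"
  unfolding dtb_relations_def ball_Un
  by (intro conjI ballI; elim CollectE exE conjE insertE emptyE; hypsubst; simp only: fst_conv snd_conv)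
    (intro free_algebra_add free_algebra_diff free_algebra_mult free_algebra_sum free_algebra_one
       generators_in_free_algebra fm_in_free_algebra permutes_compose permutes_id sref_permutes;
     simp)+

section \<open>Trace forms, dual bases and Schur's lemma\<close>

lemma finite_cbasis:
  fixes B :: "'a::complex_vector set"
  assumes "finite_dim TYPE('a)" "is_cbasis B"
  shows "finite B"
proof -
  obtain S :: "'a set" where "finite S" "cvec.span S = UNIV"
    using assms(1) by (auto simp: finite_dim_def)
  then show ?thesis
    using cvec.independent_span_bound[of S B] assms(2) by (auto simp: is_cbasis_def)
qed

text \<open>A maximal independent set shows that some basis exists, so the choice in
  \<open>ctrace\<close> does return one. This choice does not depend on the operator, hence a single
  basis computes the traces of all operators at once.\<close>

lemma ctrace_eq_sum:
  assumes "finite_dim TYPE('a::complex_vector)"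
  obtains B :: "'a::complex_vector set" where "finite B" "is_cbasis B"
    "\<And>f :: 'a \<Rightarrow> 'a. ctrace f = (\<Sum>b\<in>B. cvec.representation B (f b) b)"
proof -
  define B :: "'a set" where "B = (SOME B. is_cbasis B)"
  obtain B0 :: "'a set" where "cvec.independent B0" "UNIV \<subseteq> cvec.span B0"
    using cvec.maximal_independent_subset[of "UNIV :: 'a set"] by blast
  then have "is_cbasis B0"
    by (auto simp: is_cbasis_def)
  then have "is_cbasis B"
    unfolding B_def by (rule someI)
  then show ?thesis
    using that[of B] finite_cbasis[OF assms] by (simp add: ctrace_def B_def Let_def)
qed

lemma ctrace_add:
  fixes f g :: "'a::complex_vector \<Rightarrow> 'a"
  assumes "finite_dim TYPE('a)"
  shows "ctrace (\<lambda>w. f w + g w) = ctrace f + ctrace g"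
proof -
  obtain B :: "'a set" where "is_cbasis B"
    "\<And>f. ctrace f = (\<Sum>b\<in>B. cvec.representation B (f b) b)"
    using ctrace_eq_sum[OF assms] by metis
  then show ?thesis
    by (simp add: is_cbasis_def cvec.representation_add sum.distrib)
qed

lemma ctrace_scale:
  fixes f :: "'a::complex_vector \<Rightarrow> 'a"
  assumes "finite_dim TYPE('a)"
  shows "ctrace (\<lambda>w. c *\<^sub>C f w) = c * ctrace f"
proof -
  obtain B :: "'a set" where "is_cbasis B"
    "\<And>f. ctrace f = (\<Sum>b\<in>B. cvec.representation B (f b) b)"
    using ctrace_eq_sum[OF assms] by metis
  then show ?thesis
    by (simp add: is_cbasis_def cvec.representation_scale sum_distrib_left)
qed

lemma clinear_sum_scale:
  "clinear f \<Longrightarrow> f (\<Sum>i\<in>S. c i *\<^sub>C x i) = (\<Sum>i\<in>S. c i *\<^sub>C f (x i))"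
  by (induction S rule: infinite_finite_induct) (simp_all add: clinear_add clinear_scale clinear_zero)

lemma ctrace_commute:
  fixes f g :: "'a::complex_vector \<Rightarrow> 'a"
  assumes "finite_dim TYPE('a)" and f: "clinear f" and g: "clinear g"
  shows "ctrace (f \<circ> g) = ctrace (g \<circ> f)"
proof -
  obtain B :: "'a set" where B: "finite B" "is_cbasis B"
    and tr: "\<And>f. ctrace f = (\<Sum>b\<in>B. cvec.representation B (f b) b)"
    using ctrace_eq_sum[OF assms(1)] by metis
  let ?r = "cvec.representation B"
  have ind: "cvec.independent B" and span: "\<And>x. x \<in> cvec.span B"
    using B(2) by (auto simp: is_cbasis_def)
  have eq: "?r (f (g b)) b = (\<Sum>c\<in>B. ?r (g b) c * ?r (f c) b)"
    if f: "clinear f" for f g :: "'a \<Rightarrow> 'a" and b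
  proof -
    have "g b = (\<Sum>c\<in>B. ?r (g b) c *\<^sub>C c)"
      using cvec.sum_representation_eq[OF ind span B(1) order_refl] by simp
    then have "f (g b) = f (\<Sum>c\<in>B. ?r (g b) c *\<^sub>C c)"
      by (rule arg_cong)
    then have "f (g b) = (\<Sum>c\<in>B. ?r (g b) c *\<^sub>C f c)"
      unfolding clinear_sum_scale[OF f] .
    from arg_cong[OF this, of "\<lambda>x. ?r x b"] show ?thesis
      by (simp add: cvec.representation_sum[OF ind span] cvec.representation_scale[OF ind span])
  qed
  show ?thesis
    unfolding tr comp_def eq[OF f, of g] eq[OF g, of f]
    by (subst sum.swap) (simp add: mult.commute)
qed

lemma trace_form_bilinear:
  fixes \<theta> :: "'g::complex_vector \<Rightarrow> 'w::complex_vector \<Rightarrow> 'w"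
  assumes "finite_dim TYPE('w)" "lie_module br \<theta>"
  shows "clinear (trace_form \<theta> x)" "clinear (\<lambda>x. trace_form \<theta> x y)"
proof -
  have lin: "clinear (\<theta> x)" "clinear (\<lambda>x. \<theta> x u)" for x u
    using assms(2) by (auto simp: lie_module_def)
  show "clinear (trace_form \<theta> x)"
    by (rule clinearI) (simp_all add: trace_form_def comp_def scaleC_complex_def
        clinear_add[OF lin(2)] clinear_add[OF lin(1)] clinear_scale[OF lin(2)]
        clinear_scale[OF lin(1)] ctrace_add[OF assms(1)] ctrace_scale[OF assms(1)])
  show "clinear (\<lambda>x. trace_form \<theta> x y)"
    by (rule clinearI) (simp_all add: trace_form_def comp_def scaleC_complex_def
        clinear_add[OF lin(2)] clinear_scale[OF lin(2)]
        ctrace_add[OF assms(1)] ctrace_scale[OF assms(1)])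
qed

lemma trace_form_commute:
  fixes \<theta> :: "'g::complex_vector \<Rightarrow> 'w::complex_vector \<Rightarrow> 'w"
  assumes "finite_dim TYPE('w)" "lie_module br \<theta>"
  shows "trace_form \<theta> x y = trace_form \<theta> y x"
  using assms by (simp add: trace_form_def ctrace_commute lie_module_def)

text \<open>Write X, Y, Z for the operators of x, y, z. In tr([X,Y]Z) + tr(Y[X,Z]) the two terms YXZ
  cancel, and what remains is tr(XYZ) - tr(YZX), which vanishes by cyclicity.\<close>

lemma trace_form_invariant:
  fixes \<theta> :: "'g::complex_vector \<Rightarrow> 'w::complex_vector \<Rightarrow> 'w"
  assumes "finite_dim TYPE('w)" "lie_module br \<theta>"
  shows "trace_form \<theta> (br x y) z = - trace_form \<theta> y (br x z)"
proof -
  have lin: "\<And>x. clinear (\<theta> x)"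
    and br: "\<And>x y u. \<theta> (br x y) u = \<theta> x (\<theta> y u) - \<theta> y (\<theta> x u)"
    using assms(2) by (auto simp: lie_module_def)
  have "trace_form \<theta> (br x y) z + trace_form \<theta> y (br x z) =
      ctrace (\<lambda>w. \<theta> x (\<theta> y (\<theta> z w)) + (-1) *\<^sub>C \<theta> y (\<theta> z (\<theta> x w)))"
    unfolding trace_form_def
    by (subst ctrace_add[OF assms(1), symmetric])
      (simp add: br clinear_diff[OF lin] clinear_add[OF lin] scaleC_one)
  also have "\<dots> = ctrace (\<theta> x \<circ> (\<lambda>w. \<theta> y (\<theta> z w))) - ctrace ((\<lambda>w. \<theta> y (\<theta> z w)) \<circ> \<theta> x)"
    unfolding ctrace_add[OF assms(1)] ctrace_scale[OF assms(1)] by (simp add: comp_def)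
  also have "\<dots> = 0"
    by (subst ctrace_commute[OF assms(1) lin])
      (auto intro!: clinearI simp: clinear_add[OF lin] clinear_scale[OF lin])
  finally show ?thesis by (simp add: eq_neg_iff_add_eq_0)
qed

section \<open>Expansions in dual bases and their consequences for the Casimir tensor\<close>

lemma dual_bases_expand:
  assumes dual: "dual_bases B d b b'"
    and lin: "\<And>x. clinear (B x)" "\<And>y. clinear (\<lambda>x. B x y)"
  shows "x = (\<Sum>i<d. B x (b' i) *\<^sub>C b i)" "x = (\<Sum>i<d. B (b i) x *\<^sub>C b' i)"
proof -
  have ex: "\<exists>u. x = (\<Sum>i<d. u i *\<^sub>C c i)" if "inj_on c {..<d}" "is_cbasis (c ` {..<d})" for c
  proof -
    have "x \<in> cvec.span (c ` {..<d})"
      using that by (simp add: is_cbasis_def)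
    then obtain u where "x = (\<Sum>v\<in>c ` {..<d}. u v *\<^sub>C v)"
      by (subst (asm) cvec.span_finite) auto
    then show ?thesis
      using that(1) by (auto simp: sum.reindex)
  qed
  have B: "B (b i) (b' j) = (if i = j then 1 else 0)" if "i < d" "j < d" for i j
    using dual that by (simp add: dual_bases_def)
  obtain u where u: "x = (\<Sum>i<d. u i *\<^sub>C b i)"
    using ex[of b] dual by (auto simp: dual_bases_def)
  have "B x (b' j) = u j" if "j < d" for j
    using that unfolding u clinear_sum_scale[OF lin(2)] by (simp add: B scaleC_complex_def if_distrib cong: if_cong)
  then show "x = (\<Sum>i<d. B x (b' i) *\<^sub>C b i)"
    by (subst u) simp
  obtain u where u: "x = (\<Sum>i<d. u i *\<^sub>C b' i)"
    using ex[of b'] dual by (auto simp: dual_bases_def)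
  have "B (b j) x = u j" if "j < d" for j
    using that unfolding u clinear_sum_scale[OF lin(1)] by (simp add: B scaleC_complex_def if_distrib cong: if_cong)
  then show "x = (\<Sum>i<d. B (b i) x *\<^sub>C b' i)"
    by (subst u) simp
qed

text \<open>The witness \<open>r i j\<close> is \<open>B (br x (b i)) (b' j)\<close>, the matrix of
  the adjoint action of \<open>x\<close> in the basis \<open>b\<close>. Moving \<open>x\<close> to
  the other argument of the invariant form shows that the dual basis transforms by the negative
  transpose.\<close>

lemma dual_bases_invariant:
  assumes dual: "dual_bases B d b b'"
    and lin: "\<And>x. clinear (B x)" "\<And>y. clinear (\<lambda>x. B x y)"
    and inv: "\<And>x y z. B (br x y) z = - B y (br x z)"
  shows "\<exists>r. \<forall>i<d. br x (b i) = (\<Sum>j<d. r i j *\<^sub>C b j) \<and>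
    br x (b' i) = (\<Sum>j<d. - r j i *\<^sub>C b' j)"
proof (intro exI allI impI conjI)
  fix i
  show "br x (b i) = (\<Sum>j<d. B (br x (b i)) (b' j) *\<^sub>C b j)"
    by (rule dual_bases_expand[OF dual lin])
  show "br x (b' i) = (\<Sum>j<d. - B (br x (b j)) (b' i) *\<^sub>C b' j)"
    unfolding inv minus_minus by (rule dual_bases_expand[OF dual lin])
qed

text \<open>Written in the basis \<open>b\<close> alone, the Casimir tensor has the Gram matrix of
  the dual basis as its coefficients, and this matrix is symmetric because the form is.\<close>

lemma dual_bases_symmetric:
  assumes dual: "dual_bases B d b b'"
    and lin: "\<And>x. clinear (B x)" "\<And>y. clinear (\<lambda>x. B x y)"
    and sym: "\<And>x y. B x y = B y x"
    and \<phi>: "\<And>x. clinear (\<phi> x)" "\<And>y. clinear (\<lambda>x. \<phi> x y)"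
  shows "(\<Sum>i<d. \<phi> (b i) (b' i)) = (\<Sum>i<d. \<phi> (b' i) (b i))"
proof -
  have b': "b' i = (\<Sum>j<d. B (b' i) (b' j) *\<^sub>C b j)" for i
    by (rule dual_bases_expand[OF dual lin])
  have "(\<Sum>i<d. \<phi> (b i) (b' i)) = (\<Sum>i<d. \<Sum>j<d. B (b' i) (b' j) *\<^sub>C \<phi> (b i) (b j))"
    by (subst b') (simp add: clinear_sum_scale[OF \<phi>(1)])
  also have "\<dots> = (\<Sum>i<d. \<Sum>j<d. B (b' i) (b' j) *\<^sub>C \<phi> (b j) (b i))"
    by (subst sum.swap) (simp add: sym)
  also have "\<dots> = (\<Sum>i<d. \<phi> (b' i) (b i))"
    by (subst (3) b') (simp add: clinear_sum_scale[OF \<phi>(2)])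
  finally show ?thesis .
qed

section \<open>Eigenvectors via polynomials in an operator applied to a fixed vector (Horner
  scheme), and Schur's lemma\<close>

definition poly_apply :: "('a::complex_vector \<Rightarrow> 'a) \<Rightarrow> complex poly \<Rightarrow> 'a \<Rightarrow> 'a" where
  "poly_apply f p v = fold_coeffs (\<lambda>a w. a *\<^sub>C v + f w) p 0"

lemma poly_apply_0 [simp]: "poly_apply f 0 v = 0"
  by (simp add: poly_apply_def)

lemma poly_apply_pCons [simp]:
  "clinear f \<Longrightarrow> poly_apply f (pCons a p) v = a *\<^sub>C v + f (poly_apply f p v)"
  by (cases "p = 0 \<and> a = 0") (auto simp: poly_apply_def clinear_zero)

lemma poly_apply_add:
  "clinear f \<Longrightarrow> poly_apply f (p + q) v = poly_apply f p v + poly_apply f q v"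
  by (induction p q rule: poly_induct2) (simp_all add: clinear_add scaleC_add_left)

lemma poly_apply_smult:
  "clinear f \<Longrightarrow> poly_apply f (smult c p) v = c *\<^sub>C poly_apply f p v"
  by (induction p) (simp_all add: clinear_scale scaleC_add_right scaleC_scaleC)

lemma poly_apply_diff:
  "clinear f \<Longrightarrow> poly_apply f (p - q) v = poly_apply f p v - poly_apply f q v"
  using poly_apply_add[of f "p - q" q v] by simp

lemma poly_apply_monom:
  "clinear f \<Longrightarrow> poly_apply f (monom c i) v = c *\<^sub>C (f ^^ i) v"
  by (induction i) (simp_all add: monom_0 monom_Suc clinear_zero clinear_scale)

lemma poly_apply_sum:
  "clinear f \<Longrightarrow> poly_apply f (\<Sum>i\<in>S. p i) v = (\<Sum>i\<in>S. poly_apply f (p i) v)"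
  by (induction S rule: infinite_finite_induct) (simp_all add: poly_apply_add)

lemma annihilating_poly:
  fixes f :: "'a::complex_vector \<Rightarrow> 'a"
  assumes "finite_dim TYPE('a)" "clinear f"
  shows "\<exists>p. p \<noteq> 0 \<and> poly_apply f p v = 0"
proof -
  obtain S :: "'a set" where S: "finite S" "cvec.span S = UNIV"
    using assms(1) by (auto simp: finite_dim_def)
  define g where "g i = (f ^^ i) v" for i
  show ?thesis
  \<comment> \<open>Linear dependence is a property of sets, in which repeated iterates of
    \<open>f\<close> collapse. If two of the \<open>card S + 1\<close> iterates coincide, a
    difference of two monomials annihilates \<open>v\<close>; otherwise they outnumber a spanning
    set and are dependent.\<close>
  proof (cases "inj_on g {..card S}")
    case True
    then have "card (g ` {..card S}) > card S"
      by (simp add: card_image)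
    then have "cvec.dependent (g ` {..card S})"
      using cvec.independent_span_bound[of S "g ` {..card S}"] S by auto
    then obtain u where u: "\<exists>w\<in>g ` {..card S}. u w \<noteq> 0" "(\<Sum>w\<in>g ` {..card S}. u w *\<^sub>C w) = 0"
      by (subst (asm) cvec.dependent_finite) auto
    define p where "p = (\<Sum>i\<le>card S. monom (u (g i)) i)"
    have "coeff p i = u (g i)" if "i \<le> card S" for i
      using that by (simp add: p_def coeff_sum)
    then have "p \<noteq> 0"
      using u(1) by (metis (no_types, lifting) atMost_iff coeff_0 imageE)
    moreover have "poly_apply f p v = (\<Sum>i\<le>card S. u (g i) *\<^sub>C g i)"
      by (simp add: p_def g_def poly_apply_sum poly_apply_monom assms(2))
    then have "poly_apply f p v = 0"
      using u(2) True by (simp add: sum.reindex)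
    ultimately show ?thesis by blast
  next
    case False
    then obtain i j where ij: "i \<noteq> j" "g i = g j"
      by (auto simp: inj_on_def)
    then have "coeff (monom 1 i + monom (-1) j :: complex poly) i \<noteq> 0"
      by simp
    then have "monom 1 i + monom (-1) j \<noteq> (0 :: complex poly)"
      by (metis coeff_0)
    moreover have "poly_apply f (monom 1 i + monom (-1) j) v = 0"
      using ij by (simp add: poly_apply_add poly_apply_monom assms(2) g_def scaleC_one)
    ultimately show ?thesis by blast
  qed
qed

text \<open>Among the nonzero polynomials p with p(f) v = 0 choose one of least degree, and split
  off a root: p = (X - c) q. By minimality q(f) v is not zero, so it is an eigenvector for
  c.\<close>

lemma eigenvector_exists:
  fixes f :: "'a::complex_vector \<Rightarrow> 'a"
  assumes "finite_dim TYPE('a)" "clinear f" "(UNIV :: 'a set) \<noteq> {0}"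
  shows "\<exists>c w. w \<noteq> 0 \<and> f w = c *\<^sub>C w"
proof -
  obtain v :: 'a where v: "v \<noteq> 0"
    using assms(3) by auto
  define P where "P p \<longleftrightarrow> p \<noteq> 0 \<and> poly_apply f p v = 0" for p
  obtain p where p: "P p" "\<And>q. P q \<Longrightarrow> degree p \<le> degree q"
    using annihilating_poly[OF assms(1,2), of v] ex_has_least_nat[of P _ degree] P_def by metis
  have "degree p \<noteq> 0"
  proof
    assume "degree p = 0"
    then obtain c where "p = [:c:]"
      by (rule degree_eq_zeroE)
    with p(1) v show False
      by (simp add: P_def assms(2) clinear_zero)
  qed
  then obtain c where "poly p c = 0"
    using fundamental_theorem_of_algebra[of p] constant_degree[of p] by auto
  then obtain q where q: "p = [:-c, 1:] * q"
    by (auto simp: poly_eq_0_iff_dvd)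
  let ?w = "poly_apply f q v"
  have "q \<noteq> 0"
    using p(1) q by (auto simp: P_def)
  then have "degree p = Suc (degree q)"
    unfolding q by (subst degree_mult_eq) auto
  then have "?w \<noteq> 0"
    using p(2)[of q] \<open>q \<noteq> 0\<close> by (auto simp: P_def)
  moreover have "poly_apply f p v = - (c *\<^sub>C ?w) + f ?w"
    unfolding q using assms(2) by (simp add: poly_apply_add poly_apply_diff poly_apply_smult)
  then have "f ?w = c *\<^sub>C ?w"
    using p(1) by (simp add: P_def)
  ultimately show ?thesis by blast
qed

text \<open>The cancellation of \<open>casimir_act\<close>, carried out on a single module. The
  scalar on V has to be known before the locale can be interpreted.\<close>

lemma casimir_op_commute:
  fixes \<rho> :: "'g::complex_vector \<Rightarrow> 'u::complex_vector \<Rightarrow> 'u"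
  assumes \<rho>: "lie_module br \<rho>"
    and inv: "\<exists>r. \<forall>i<d. br x (b i) = (\<Sum>j<d. r i j *\<^sub>C b j) \<and>
      br x (b' i) = (\<Sum>j<d. - r j i *\<^sub>C b' j)"
  shows "casimir_op d b b' \<rho> (\<rho> x u) = \<rho> x (casimir_op d b b' \<rho> u)"
proof -
  have lin: "\<And>x. clinear (\<rho> x)" "\<And>u. clinear (\<lambda>x. \<rho> x u)"
    and br: "\<And>x y u. \<rho> (br x y) u = \<rho> x (\<rho> y u) - \<rho> y (\<rho> x u)"
    using \<rho> by (auto simp: lie_module_def)
  obtain r where r: "\<And>i. i < d \<Longrightarrow> br x (b i) = (\<Sum>j<d. r i j *\<^sub>C b j)"
    "\<And>i. i < d \<Longrightarrow> br x (b' i) = (\<Sum>j<d. - r j i *\<^sub>C b' j)"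
    using inv by blast
  have sum: "\<rho> x (\<Sum>i\<in>S. f i) = (\<Sum>i\<in>S. \<rho> x (f i))" for S and f :: "nat \<Rightarrow> 'u"
    using clinear_sum_scale[OF lin(1), of x "\<lambda>_. 1" f S] by (simp add: scaleC_one)
  have "\<rho> x (casimir_op d b b' \<rho> u) - casimir_op d b b' \<rho> (\<rho> x u) =
      (\<Sum>i<d. \<rho> (br x (b i)) (\<rho> (b' i) u) + \<rho> (b i) (\<rho> (br x (b' i)) u))"
    by (simp add: casimir_op_def sum br clinear_diff[OF lin(1)] flip: sum_subtractf)
  also have "\<dots> = (\<Sum>i<d. \<Sum>j<d. r i j *\<^sub>C \<rho> (b j) (\<rho> (b' i) u))
      + (\<Sum>i<d. \<Sum>j<d. - r j i *\<^sub>C \<rho> (b i) (\<rho> (b' j) u))"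
    unfolding sum.distrib
    by (intro arg_cong2[of _ _ _ _ "(+)"] sum.cong refl)
      (simp_all only: lessThan_iff r clinear_sum_scale[OF lin(1)] clinear_sum_scale[OF lin(2)])
  also have "\<dots> = 0"
    by (subst sum.swap) (simp add: sum_negf)
  finally show ?thesis by simp
qed

lemma casimir_op_simple:
  fixes \<rho> :: "'g::complex_vector \<Rightarrow> 'u::complex_vector \<Rightarrow> 'u"
  assumes fin: "finite_dim TYPE('u)" and simple: "simple_module br \<rho>"
    and inv: "\<And>x. \<exists>r. \<forall>i<d. br x (b i) = (\<Sum>j<d. r i j *\<^sub>C b j) \<and>
      br x (b' i) = (\<Sum>j<d. - r j i *\<^sub>C b' j)"
  shows "casimir_op d b b' \<rho> u = casimir_scalar d b b' \<rho> *\<^sub>C u"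
proof -
  let ?f = "casimir_op d b b' \<rho>"
  have \<rho>: "lie_module br \<rho>" and nz: "(UNIV :: 'u set) \<noteq> {0}"
    and sub: "\<And>W. cvec.subspace W \<Longrightarrow> (\<And>x w. w \<in> W \<Longrightarrow> \<rho> x w \<in> W) \<Longrightarrow> W = {0} \<or> W = UNIV"
    using simple by (auto simp: simple_module_def)
  have lin: "clinear (\<rho> x)" for x
    using \<rho> by (auto simp: lie_module_def)
  have f: "clinear ?f"
    by (rule clinearI)
      (simp_all add: casimir_op_def clinear_add[OF lin] clinear_scale[OF lin] sum.distrib
        cvec.scale_sum_right)
  obtain c w where cw: "w \<noteq> 0" "?f w = c *\<^sub>C w"
    using eigenvector_exists[OF fin f nz] by blast
  let ?W = "{v. ?f v = c *\<^sub>C v}"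
  have "cvec.subspace ?W"
    by (rule cvec.subspaceI)
      (simp_all add: clinear_zero[OF f] clinear_add[OF f] clinear_scale[OF f] scaleC_add_right mult.commute)
  moreover have "\<rho> x v \<in> ?W" if "v \<in> ?W" for x v
    using that casimir_op_commute[OF \<rho> inv] by (simp add: clinear_scale[OF lin])
  ultimately have "?W = UNIV"
    using sub[of ?W] cw by auto
  then have c: "?f v = c *\<^sub>C v" for v
    by auto
  \<comment> \<open>The definite description needs uniqueness, which follows by comparing two
    candidates on the nonzero eigenvector \<open>w\<close>.\<close>
  have "casimir_scalar d b b' \<rho> = c"
    unfolding casimir_scalar_def
  proof (rule the_equality)
    show "\<forall>u. ?f u = c *\<^sub>C u" using c by simp
    fix c' assume "\<forall>u. ?f u = c' *\<^sub>C u"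
    then have "c' *\<^sub>C w = c *\<^sub>C w" using c by metis
    then show "c' = c" using cw(1) by simp
  qed
  with c show ?thesis by simp
qed

section \<open>Operators on tensor powers\<close>

lemma pure_tensor_linear:
  "pure_tensor (c *\<^sub>C m + m') n vs = c *\<^sub>C pure_tensor m n vs + pure_tensor m' n vs"
  "pure_tensor m (c *\<^sub>C n + n') vs = c *\<^sub>C pure_tensor m n vs + pure_tensor m n' vs"
  "pure_tensor m n (us @ (c *\<^sub>C v + v') # ws)
    = c *\<^sub>C pure_tensor m n (us @ v # ws) + pure_tensor m n (us @ v' # ws)"
  by (transfer, unfold tensor_rel_def, rule cvec.span_base,
    unfold multilinear_relations_def, blast)+

lemma clinearI':
  assumes "\<And>c x y. f (c *\<^sub>C x + y) = c *\<^sub>C f x + f y"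
  shows "clinear f"
proof (rule clinearI)
  show add: "f (x + y) = f x + f y" for x y
    using assms[of 1 x y] by (simp add: scaleC_one)
  have "f 0 = 0"
    using add[of 0 0] by simp
  then show "f (c *\<^sub>C x) = c *\<^sub>C f x" for c x
    using assms[of c x 0] by simp
qed

lemma split_at_update: "i < length vs \<Longrightarrow> vs[i := v] = take i vs @ v # drop (Suc i) vs"
  by (rule upd_conv_take_nth_drop)

lemma clinear_pure_tensor:
  "clinear (\<lambda>m. pure_tensor m n vs)"
  "clinear (\<lambda>n. pure_tensor m n vs)"
  "i < length vs \<Longrightarrow> clinear (\<lambda>v. pure_tensor m n (vs[i := v]))"
  by (rule clinearI', simp add: split_at_update pure_tensor_linear)+

lemma multilinearI:
  assumes "\<And>n vs. clinear (\<lambda>m. F m n vs)" "\<And>m vs. clinear (\<lambda>n. F m n vs)"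
    and upd: "\<And>m n vs i. i < length vs \<Longrightarrow> clinear (\<lambda>v. F m n (vs[i := v]))"
  shows "multilinear F"
proof -
  have "F m n (us @ (c *\<^sub>C v + v') # ws) = c *\<^sub>C F m n (us @ v # ws) + F m n (us @ v' # ws)"
    for c m n us v v' ws
  proof -
    \<comment> \<open>The entry 0 is a placeholder: updating it produces every list of the form
      \<open>us @ v # ws\<close>.\<close>
    note lin = upd[of "length us" "us @ 0 # ws" m n]
    show ?thesis
      using clinear_add[OF lin] clinear_scale[OF lin] by simp
  qed
  then show ?thesis
    unfolding multilinear_def
    using clinear_add[OF assms(1)] clinear_scale[OF assms(1)] clinear_add[OF assms(2)]
      clinear_scale[OF assms(2)]
    by simp
qed

lemma tensor_ext:
  assumes "clinear f" "clinear g"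
    and "\<And>m n vs. f (pure_tensor m n vs) = g (pure_tensor m n vs)"
  shows "f = g"
proof -
  have "multilinear (\<lambda>m n vs. f (pure_tensor m n vs))"
    unfolding multilinear_def
    by (simp add: pure_tensor_linear clinear_add[OF assms(1)] clinear_scale[OF assms(1)])
  from tensor_lift_ex1[OF this] show ?thesis
    using assms by metis
qed

lemma clinear_comp: "clinear f \<Longrightarrow> clinear g \<Longrightarrow> clinear (\<lambda>x. f (g x))"
  by (rule clinearI) (simp_all add: clinear_add clinear_scale)

lemma clinear_sum: "(\<And>i. i \<in> S \<Longrightarrow> clinear (f i)) \<Longrightarrow> clinear (\<lambda>x. \<Sum>i\<in>S. f i x)"
  by (rule clinearI) (simp_all add: clinear_add clinear_scale sum.distrib cvec.scale_sum_right)

lemma endo_tensor_eqI: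
  "(\<And>m n vs. Rep_endo f (pure_tensor m n vs) = Rep_endo g (pure_tensor m n vs)) \<Longrightarrow> f = g"
  by (rule endo_eqI, rule fun_cong[of "Rep_endo f"], rule tensor_ext) simp_all

definition lift_endo ::
  "('m::complex_vector \<Rightarrow> 'n::complex_vector \<Rightarrow> 'v::complex_vector list \<Rightarrow> ('m, 'n, 'v) tensor)
    \<Rightarrow> ('m, 'n, 'v) tensor endo" where
  "lift_endo F = Abs_endo (tensor_lift F)"

lemma Rep_lift_endo: "multilinear F \<Longrightarrow> Rep_endo (lift_endo F) = tensor_lift F"
  by (simp add: lift_endo_def Abs_endo_inverse tensor_lift_linear)

lemma lift_endo_pure:
  "multilinear F \<Longrightarrow> Rep_endo (lift_endo F) (pure_tensor m n vs) = F m n vs"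
  by (simp add: Rep_lift_endo tensor_lift_pure)

text \<open>Changing an entry leaves the length of the list unchanged, so both sides of each
  linearity condition fall into the same branch. This permits operators that behave differently in
  different degrees.\<close>

lemma multilinear_if_length:
  "multilinear F \<Longrightarrow> multilinear G \<Longrightarrow>
    multilinear (\<lambda>m n vs. if P (length vs) then F m n vs else G m n vs)"
  unfolding multilinear_def by simp

lemma multilinear_zero: "multilinear (\<lambda>m n vs. 0)"
  unfolding multilinear_def by simp

lemma multilinear_pure_tensor: "multilinear pure_tensor"
  by (rule multilinearI) (auto intro: clinear_pure_tensor)

text \<open>Multiplying by this projection onto degree \<open>k\<close> turns an equality that holds
  only on \<open>tensor_power k\<close> into an equality of operators on all tensors.\<close>

definition proj :: "nat \<Rightarrow> ('m::complex_vector, 'n::complex_vector, 'v::complex_vector) tensor endo"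
  where "proj k = lift_endo (\<lambda>m n vs. if length vs = k then pure_tensor m n vs else 0)"

lemma proj_pure [simp]:
  "Rep_endo (proj k) (pure_tensor m n vs) = (if length vs = k then pure_tensor m n vs else 0)"
  unfolding proj_def
  by (rule lift_endo_pure multilinear_if_length multilinear_pure_tensor multilinear_zero)+

lemma subspace_tensor_power: "cvec.subspace (tensor_power k)"
  unfolding tensor_power_def by (rule cvec.subspace_span)

lemma proj_tensor_power: "u \<in> tensor_power k \<Longrightarrow> Rep_endo (proj k) u = u"
  unfolding tensor_power_def
  by (induction rule: cvec.span_induct_alt) (auto simp: endo_zero endo_add endo_scale)

lemma proj_in_tensor_power: "Rep_endo (proj k) u \<in> tensor_power k"
proof (induction u rule: tensor.abs_induct)
  case (1 f)
  note sub = subspace_tensor_power[of k]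
  show ?case
  proof (induction f rule: pretensor_induct)
    case zero
    then show ?case
      by (simp flip: zero_tensor.abs_eq add: endo_zero cvec.subspace_0[OF sub])
  next
    case (pure x)
    obtain m n vs where x: "x = (m, n, vs)" by (cases x)
    have "pure_tensor m n vs \<in> tensor_power k" if "length vs = k"
      unfolding tensor_power_def using that by (intro cvec.span_base) blast
    then show ?case
      unfolding x by (simp flip: pure_tensor.abs_eq add: cvec.subspace_0[OF sub])
  next
    case (add f g)
    then show ?case
      by (simp flip: plus_tensor.abs_eq add: endo_add cvec.subspace_add[OF sub])
  next
    case (scale c f)
    then show ?case
      by (simp flip: scaleC_tensor.abs_eq add: endo_scale cvec.subspace_scale[OF sub])
  qed
qed

section \<open>Permutations of the copies of V\<close>

text \<open>The \<open>j\<close>-th factor is moved to position \<open>w j\<close>.  Positions start from 1, list indices from 0.\<close>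

definition permute_tensor_list :: "(nat \<Rightarrow> nat) \<Rightarrow> 'v list \<Rightarrow> 'v list" where
  "permute_tensor_list w vs = map (\<lambda>j. vs ! (Hilbert_Choice.inv w (Suc j) - 1)) [0..<length vs]"

lemma length_permute_tensor_list [simp]: "length (permute_tensor_list w vs) = length vs"
  by (simp add: permute_tensor_list_def)

lemma nth_permute_tensor_list:
  "j < length vs \<Longrightarrow> permute_tensor_list w vs ! j = vs ! (Hilbert_Choice.inv w (Suc j) - 1)"
  by (simp add: permute_tensor_list_def)

lemma permute_tensor_list_id [simp]: "permute_tensor_list id vs = vs"
  by (simp add: permute_tensor_list_def map_nth)

lemma permutes_interval_bounds:
  assumes "w permutes {1..k}" "j < k"
  shows "1 \<le> w (Suc j)" "w (Suc j) \<le> k" "w (Suc j) - 1 < k"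
  using permutes_in_image[OF assms(1), of "Suc j"] assms(2) by auto

lemma permute_tensor_list_update:
  assumes w: "w permutes {1..length vs}" and i: "i < length vs"
  shows "permute_tensor_list w (vs[i := v]) = (permute_tensor_list w vs)[w (Suc i) - 1 := v]"
proof (rule nth_equalityI)
  fix j assume "j < length (permute_tensor_list w (vs[i := v]))"
  then have j: "j < length vs" by simp
  \<comment> \<open>Truncated subtraction of 1 loses nothing here, since \<open>w\<close> and its
    inverse map positions to positions, which are at least 1.\<close>
  have "Hilbert_Choice.inv w (Suc j) - 1 = i \<longleftrightarrow> Hilbert_Choice.inv w (Suc j) = Suc i"
    using permutes_interval_bounds[OF permutes_inv[OF w] j] by auto
  also have "\<dots> \<longleftrightarrow> w (Suc i) = Suc j"
    using permutes_inverses[OF w] by metis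
  also have "\<dots> \<longleftrightarrow> w (Suc i) - 1 = j"
    using permutes_interval_bounds[OF w i] by auto
  finally show "permute_tensor_list w (vs[i := v]) ! j =
      (permute_tensor_list w vs)[w (Suc i) - 1 := v] ! j"
    using permutes_interval_bounds[OF permutes_inv[OF w] j] permutes_interval_bounds[OF w i] i j
    by (auto simp: nth_permute_tensor_list nth_list_update)
qed simp

text \<open>Entries are looked up through the inverse permutation, and inversion reverses the order
  of composition; hence this is a left action, as the relation for products of permutations
  requires.\<close>

lemma permute_tensor_list_comp:
  assumes w: "w permutes {1..length vs}" and w': "w' permutes {1..length vs}"
  shows "permute_tensor_list w (permute_tensor_list w' vs) = permute_tensor_list (w \<circ> w') vs"
proof (rule nth_equalityI)
  fix j assume "j < length (permute_tensor_list w (permute_tensor_list w' vs))"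
  then have j: "j < length vs" by simp
  have "Hilbert_Choice.inv (w \<circ> w') = Hilbert_Choice.inv w' \<circ> Hilbert_Choice.inv w"
    using w w' by (intro o_inv_distrib) (auto intro: permutes_bij)
  then show "permute_tensor_list w (permute_tensor_list w' vs) ! j = permute_tensor_list (w \<circ> w') vs ! j"
    using permutes_interval_bounds[OF permutes_inv[OF w] j] j
    by (simp add: nth_permute_tensor_list)
qed simp

text \<open>The permutation is allowed to depend on the length, because \<open>perm_endo\<close> and
  \<open>flip_op\<close> switch to the identity in certain degrees.\<close>

lemma multilinear_permute:
  assumes "\<And>l. \<sigma> l permutes {1..l}"
  shows "multilinear (\<lambda>(m :: 'm::complex_vector) (n :: 'n::complex_vector) (vs :: 'v::complex_vector list).
    pure_tensor m n (permute_tensor_list (\<sigma> (length vs)) vs))"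
proof (rule multilinearI)
  fix m :: 'm and n :: 'n and vs :: "'v list" and i assume i: "i < length vs"
  show "clinear (\<lambda>v. pure_tensor m n (permute_tensor_list (\<sigma> (length (vs[i := v]))) (vs[i := v])))"
    using permutes_interval_bounds[OF assms i] i assms
    by (simp add: permute_tensor_list_update clinear_pure_tensor)
qed (rule clinear_pure_tensor)+

text \<open>The identity, and not zero, is used outside degree \<open>k\<close>, so that the neutral
  permutation acts as the unit of the algebra of all endomorphisms.\<close>

definition perm_endo ::
  "nat \<Rightarrow> (nat \<Rightarrow> nat) \<Rightarrow> ('m::complex_vector, 'n::complex_vector, 'v::complex_vector) tensor endo" where
  "perm_endo k w = lift_endo (\<lambda>m n vs.
    pure_tensor m n (permute_tensor_list (if length vs = k then w else id) vs))"

lemma perm_endo_pure [simp]: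
  assumes "w permutes {1..k}"
  shows "Rep_endo (perm_endo k w) (pure_tensor m n vs) =
    pure_tensor m n (permute_tensor_list (if length vs = k then w else id) vs)"
  unfolding perm_endo_def
  by (rule lift_endo_pure, rule multilinear_permute) (use assms in \<open>simp add: permutes_id[unfolded id_def]\<close>)

lemma perm_endo_comp:
  assumes "w permutes {1..k}" "w' permutes {1..k}"
  shows "perm_endo k w * perm_endo k w' = perm_endo k (w \<circ> w')"
  by (rule endo_tensor_eqI)
    (use assms in \<open>simp add: endo_simps permutes_compose permute_tensor_list_comp\<close>)

lemma perm_endo_id: "perm_endo k id = 1"
  by (rule endo_tensor_eqI) (simp add: endo_simps permutes_id)

lemma perm_endo_proj: "w permutes {1..k} \<Longrightarrow> perm_endo k w * proj k = proj k * perm_endo k w"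
  by (rule endo_tensor_eqI) (simp add: endo_simps endo_zero)

lemma permute_tensor_list_sref:
  assumes "1 \<le> i" "i < length vs"
  shows "permute_tensor_list (sref i) vs = vs[i - 1 := vs ! i, i := vs ! (i - 1)]"
proof (rule nth_equalityI)
  fix j assume "j < length (permute_tensor_list (sref i) vs)"
  then have j: "j < length vs" by simp
  have "Hilbert_Choice.inv (sref i) = sref i"
    by (rule inv_unique_comp) simp_all
  then show "permute_tensor_list (sref i) vs ! j = vs[i - 1 := vs ! i, i := vs ! (i - 1)] ! j"
    using assms j
    by (auto simp: nth_permute_tensor_list nth_list_update sref_def Transposition.transpose_def)
qed simp

text \<open>\<open>flip_op i\<close> exchanges two factors in every degree above i,
  \<open>perm_endo k\<close> permutes in degree \<open>k\<close> only; composed with the projection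
  onto this degree they agree.\<close>

lemma flip_op_eq:
  assumes i: "i \<in> {1..<k}" and u: "u \<in> tensor_power k"
  shows "flip_op i u = Rep_endo (perm_endo k (sref i)) u"
proof -
  let ?\<sigma> = "\<lambda>l. if i < l then sref i else id"
  have \<sigma>: "?\<sigma> l permutes {1..l}" for l
  proof (cases "i < l")
    case True
    with i have "i \<in> {1..<l}" by simp
    with True show ?thesis by (simp only: sref_permutes if_True)
  qed (simp add: permutes_id)
  let ?F = "\<lambda>m n vs. pure_tensor m n (permute_tensor_list (?\<sigma> (length vs)) vs)"
  have F: "multilinear ?F"
    by (rule multilinear_permute) (rule \<sigma>)
  have "flip_op i = tensor_lift ?F"
    unfolding flip_op_def
    by (rule arg_cong[of _ _ tensor_lift]) (use i in \<open>auto simp: fun_eq_iff permute_tensor_list_sref\<close>)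
  then have flip: "flip_op i = Rep_endo (lift_endo ?F)"
    by (simp only: Rep_lift_endo[OF F])
  have "lift_endo ?F * proj k = perm_endo k (sref i) * proj k"
    by (rule endo_tensor_eqI)
      (use i in \<open>simp add: endo_simps endo_zero lift_endo_pure[OF F] perm_endo_pure[OF sref_permutes[OF i]]\<close>)
  from arg_cong[OF this, of "\<lambda>e. Rep_endo e u"] show ?thesis
    by (simp only: flip times_endo.rep_eq proj_tensor_power[OF u])
qed

section \<open>The Lie algebra acting on single tensor factors\<close>

context
  fixes br :: "'g::complex_vector \<Rightarrow> 'g \<Rightarrow> 'g"
    and \<rho>M :: "'g \<Rightarrow> 'm::complex_vector \<Rightarrow> 'm"
    and \<rho>N :: "'g \<Rightarrow> 'n::complex_vector \<Rightarrow> 'n"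
    and \<rho>V :: "'g \<Rightarrow> 'v::complex_vector \<Rightarrow> 'v"
  assumes \<rho>M: "lie_module br \<rho>M" and \<rho>N: "lie_module br \<rho>N" and \<rho>V: "lie_module br \<rho>V"
begin

lemma rep_linear:
  "clinear (\<rho>M x)" "clinear (\<rho>N x)" "clinear (\<rho>V x)"
  "clinear (\<lambda>x. \<rho>M x m)" "clinear (\<lambda>x. \<rho>N x n)" "clinear (\<lambda>x. \<rho>V x v)"
  using \<rho>M \<rho>N \<rho>V by (auto simp: lie_module_def)

lemma rep_bracket:
  "\<rho>M (br x y) m = \<rho>M x (\<rho>M y m) - \<rho>M y (\<rho>M x m)"
  "\<rho>N (br x y) n = \<rho>N x (\<rho>N y n) - \<rho>N y (\<rho>N x n)"
  "\<rho>V (br x y) v = \<rho>V x (\<rho>V y v) - \<rho>V y (\<rho>V x v)"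
  using \<rho>M \<rho>N \<rho>V by (auto simp: lie_module_def)

definition slot_pure :: "slot \<Rightarrow> 'g \<Rightarrow> 'm \<Rightarrow> 'n \<Rightarrow> 'v list \<Rightarrow> ('m, 'n, 'v) tensor" where
  "slot_pure p x m n vs = (case p of
     SlotM \<Rightarrow> pure_tensor (\<rho>M x m) n vs
   | SlotN \<Rightarrow> pure_tensor m (\<rho>N x n) vs
   | SlotV j \<Rightarrow> pure_tensor m n (vs[j - 1 := \<rho>V x (vs ! (j - 1))]))"

lemma slot_pure_simps [simp]:
  "slot_pure SlotM x m n vs = pure_tensor (\<rho>M x m) n vs"
  "slot_pure SlotN x m n vs = pure_tensor m (\<rho>N x n) vs"
  "slot_pure (SlotV j) x m n vs = pure_tensor m n (vs[j - 1 := \<rho>V x (vs ! (j - 1))])"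
  by (simp_all add: slot_pure_def)

lemma multilinear_slot_pure: "multilinear (slot_pure p x)"
proof (rule multilinearI)
  fix m :: 'm and n :: 'n and vs :: "'v list"
  show "clinear (\<lambda>m. slot_pure p x m n vs)"
    by (cases p) (auto intro: clinear_pure_tensor clinear_comp[OF clinear_pure_tensor(1) rep_linear(1)])
  show "clinear (\<lambda>n. slot_pure p x m n vs)"
    by (cases p) (auto intro: clinear_pure_tensor clinear_comp[OF clinear_pure_tensor(2) rep_linear(2)])
  fix i assume i: "i < length vs"
  show "clinear (\<lambda>v. slot_pure p x m n (vs[i := v]))"
  proof (cases p)
    case (SlotV j)
    show ?thesis
    proof (cases "j - 1 = i")
      case True
      with i SlotV show ?thesis
        using clinear_comp[OF clinear_pure_tensor(3)[OF i] rep_linear(3)] by simp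
    next
      case False
      with i SlotV show ?thesis
        using clinear_pure_tensor(3)[of i "vs[j - 1 := \<rho>V x (vs ! (j - 1))]"]
        by (simp add: list_update_swap)
    qed
  qed (use i in \<open>auto intro: clinear_pure_tensor\<close>)
qed

text \<open>\<open>slot_act\<close> is the identity on pure tensors that lack the factor \<open>p\<close>, hence not linear in \<open>x\<close>
  there.  Cutting off all degrees other than \<open>k\<close> makes \<open>slot_endo k p\<close> a representation.\<close>

definition slot_endo :: "nat \<Rightarrow> slot \<Rightarrow> 'g \<Rightarrow> ('m, 'n, 'v) tensor endo" where
  "slot_endo k p x = lift_endo (\<lambda>m n vs. if length vs = k then slot_pure p x m n vs else 0)"

lemma slot_endo_pure [simp]:
  "Rep_endo (slot_endo k p x) (pure_tensor m n vs) =
    (if length vs = k then slot_pure p x m n vs else 0)"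
  unfolding slot_endo_def
  by (rule lift_endo_pure multilinear_if_length multilinear_slot_pure multilinear_zero)+

lemma slot_act_eq:
  assumes u: "u \<in> tensor_power k"
  shows "slot_act \<rho>M \<rho>N \<rho>V p x u = Rep_endo (slot_endo k p x) u"
proof -
  have "slot_act \<rho>M \<rho>N \<rho>V p x = tensor_lift (slot_pure p x)"
    by (simp add: slot_act_def slot_pure_def[abs_def])
  then have act: "slot_act \<rho>M \<rho>N \<rho>V p x = Rep_endo (lift_endo (slot_pure p x))"
    by (simp only: Rep_lift_endo[OF multilinear_slot_pure])
  have "lift_endo (slot_pure p x) * proj k = slot_endo k p x"
    by (rule endo_tensor_eqI)
      (simp add: endo_simps endo_zero lift_endo_pure[OF multilinear_slot_pure])
  from arg_cong[OF this, of "\<lambda>e. Rep_endo e u"] show ?thesis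
    by (simp only: act times_endo.rep_eq proj_tensor_power[OF u])
qed

lemma slot_pure_proj: "length vs = k \<Longrightarrow> Rep_endo (proj k) (slot_pure p x m n vs) = slot_pure p x m n vs"
  by (cases p) simp_all

lemma slot_endo_proj:
  "proj k * slot_endo k p x = slot_endo k p x" "slot_endo k p x * proj k = slot_endo k p x"
  by (rule endo_tensor_eqI; simp add: endo_simps endo_zero slot_pure_proj)+

lemma slot_endo_linear:
  assumes "p \<in> all_slots k"
  shows "clinear (slot_endo k p)"
proof -
  have lin: "clinear (\<lambda>x. slot_pure p x m n vs)" if "length vs = k" for m n and vs :: "'v list"
  proof (cases p)
    case (SlotV j)
    with assms that have "j - 1 < length vs" by auto
    with SlotV show ?thesis
      using clinear_comp[OF clinear_pure_tensor(3) rep_linear(6)] by simp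
  qed (use clinear_comp[OF clinear_pure_tensor(1) rep_linear(4)]
      clinear_comp[OF clinear_pure_tensor(2) rep_linear(5)] in simp_all)
  show ?thesis
    by (rule clinearI; rule endo_tensor_eqI)
      (simp_all add: endo_simps clinear_add[OF lin] clinear_scale[OF lin])
qed

lemma slot_endo_bracket:
  assumes "p \<in> all_slots k"
  shows "slot_endo k p (br x y) = slot_endo k p x * slot_endo k p y - slot_endo k p y * slot_endo k p x"
proof (rule endo_tensor_eqI)
  fix m :: 'm and n :: 'n and vs :: "'v list"
  show "Rep_endo (slot_endo k p (br x y)) (pure_tensor m n vs) =
      Rep_endo (slot_endo k p x * slot_endo k p y - slot_endo k p y * slot_endo k p x) (pure_tensor m n vs)"
  proof (cases "length vs = k")
    case True
    then show ?thesis
    proof (cases p)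
      case (SlotV j)
      with assms True have "j - 1 < length vs" by auto
      with True SlotV show ?thesis
        by (simp add: endo_simps rep_bracket clinear_diff[OF clinear_pure_tensor(3)])
    qed (simp_all add: endo_simps rep_bracket clinear_diff[OF clinear_pure_tensor(1)]
        clinear_diff[OF clinear_pure_tensor(2)])
  qed (simp add: endo_simps endo_zero)
qed

lemma slot_endo_commute:
  assumes "p \<in> all_slots k" "q \<in> all_slots k" "p \<noteq> q"
  shows "slot_endo k p x * slot_endo k q y = slot_endo k q y * slot_endo k p x"
proof (rule endo_tensor_eqI)
  fix m :: 'm and n :: 'n and vs :: "'v list"
  show "Rep_endo (slot_endo k p x * slot_endo k q y) (pure_tensor m n vs) =
      Rep_endo (slot_endo k q y * slot_endo k p x) (pure_tensor m n vs)"
  proof (cases "\<exists>i j. p = SlotV i \<and> q = SlotV j")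
    case True
    then obtain i j where ij: "p = SlotV i" "q = SlotV j" by blast
    \<comment> \<open>Copies 0 and 1 would share the list index 0; membership in
      \<open>all_slots k\<close> excludes copy 0.\<close>
    with assms have "i - 1 \<noteq> j - 1" by auto
    with ij show ?thesis
      by (simp add: endo_simps endo_zero list_update_swap)
  next
    case False
    with assms(3) show ?thesis
      by (cases p; cases q) (auto simp: endo_simps endo_zero)
  qed
qed

lemma perm_endo_slot_endo:
  assumes w: "w permutes {1..k}" and p: "p \<in> all_slots k"
  shows "perm_endo k w * slot_endo k p x = slot_endo k (permute_slot w p) x * perm_endo k w"
proof (rule endo_tensor_eqI)
  fix m :: 'm and n :: 'n and vs :: "'v list"
  show "Rep_endo (perm_endo k w * slot_endo k p x) (pure_tensor m n vs) =
      Rep_endo (slot_endo k (permute_slot w p) x * perm_endo k w) (pure_tensor m n vs)"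
  proof (cases "length vs = k")
    case len: True
    show ?thesis
    proof (cases p)
      case (SlotV j)
      with p have j: "1 \<le> j" "j \<le> k" by auto
      then have j': "j - 1 < k" "Suc (j - 1) = j" by auto
      have wj: "w j - 1 < k" "Suc (w j - 1) = w j"
        using permutes_interval_bounds[OF w j'(1)] j'(2) by auto
      have "permute_tensor_list w vs ! (w j - 1) = vs ! (j - 1)"
        using wj permutes_inverses[OF w] len by (simp add: nth_permute_tensor_list)
      moreover have "permute_tensor_list w (vs[j - 1 := v]) = (permute_tensor_list w vs)[w j - 1 := v]" for v
        using permute_tensor_list_update[of w vs "j - 1"] w len j' by simp
      ultimately show ?thesis
        using SlotV len w by (simp add: endo_simps)
    qed (use len w in \<open>simp_all add: endo_simps\<close>)
  qed (use w in \<open>simp add: endo_simps endo_zero\<close>)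
qed

text \<open>The slot operators vanish outside degree \<open>k\<close>, so the scalar by which the
  Casimir element acts on V appears multiplied by \<open>proj k\<close>. This is the element
  \<open>C\<close> of the locale.\<close>

lemma slot_endo_casimir:
  assumes V: "\<And>v. casimir_op d b b' \<rho>V v = c *\<^sub>C v" and j: "j \<in> {1..k}"
  shows "(\<Sum>i<d. slot_endo k (SlotV j) (b i) * slot_endo k (SlotV j) (b' i)) = c *\<^sub>C proj k"
proof (rule endo_tensor_eqI)
  fix m :: 'm and n :: 'n and vs :: "'v list"
  show "Rep_endo (\<Sum>i<d. slot_endo k (SlotV j) (b i) * slot_endo k (SlotV j) (b' i)) (pure_tensor m n vs) =
      Rep_endo (c *\<^sub>C proj k) (pure_tensor m n vs)"
  proof (cases "length vs = k")
    case True
    with j have jl: "j - 1 < length vs" by auto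
    have sum: "(\<Sum>i<d. pure_tensor m n (vs[j - 1 := f i])) = pure_tensor m n (vs[j - 1 := \<Sum>i<d. f i])" for f
    proof (induction d)
      case 0
      show ?case by (simp add: clinear_zero[OF clinear_pure_tensor(3)[OF jl]] del: One_nat_def)
    next
      case (Suc d)
      then show ?case by (simp add: clinear_add[OF clinear_pure_tensor(3)[OF jl]] del: One_nat_def)
    qed
    have "Rep_endo (\<Sum>i<d. slot_endo k (SlotV j) (b i) * slot_endo k (SlotV j) (b' i)) (pure_tensor m n vs) =
        (\<Sum>i<d. pure_tensor m n (vs[j - 1 := \<rho>V (b i) (\<rho>V (b' i) (vs ! (j - 1)))]))"
      using True jl by (simp add: endo_simps Rep_endo_sum)
    also have "\<dots> = pure_tensor m n (vs[j - 1 := c *\<^sub>C (vs ! (j - 1))])"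
      unfolding sum V[of "vs ! (j - 1)", unfolded casimir_op_def] ..
    also have "\<dots> = c *\<^sub>C pure_tensor m n vs"
      by (simp add: clinear_scale[OF clinear_pure_tensor(3)[OF jl]] del: One_nat_def)
    finally show ?thesis
      using True by (simp add: endo_simps)
  qed (simp add: endo_simps Rep_endo_sum endo_zero)
qed

lemma gamma_MN_eq:
  assumes u: "u \<in> tensor_power k"
  shows "gamma_MN d b b' \<rho>M \<rho>N u =
    Rep_endo (\<Sum>i<d. slot_endo k SlotM (b i) * slot_endo k SlotN (b' i)) u"
proof -
  let ?F = "\<lambda>m n vs. \<Sum>i<d. pure_tensor (\<rho>M (b i) m) (\<rho>N (b' i) n) (vs :: 'v list)"
  have F: "multilinear ?F"
    by (rule multilinearI; intro clinear_sum)
      (auto intro: clinear_pure_tensor clinear_comp[OF clinear_pure_tensor(1) rep_linear(1)]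
        clinear_comp[OF clinear_pure_tensor(2) rep_linear(2)])
  have gamma: "gamma_MN d b b' \<rho>M \<rho>N = Rep_endo (lift_endo ?F)"
    by (simp only: Rep_lift_endo[OF F] gamma_MN_def)
  have "lift_endo ?F * proj k = (\<Sum>i<d. slot_endo k SlotM (b i) * slot_endo k SlotN (b' i))"
    by (rule endo_tensor_eqI) (simp add: endo_simps endo_zero Rep_endo_sum lift_endo_pure[OF F])
  from arg_cong[OF this, of "\<lambda>e. Rep_endo e u"] show ?thesis
    by (simp only: gamma times_endo.rep_eq proj_tensor_power[OF u])
qed

end

section \<open>The representation\<close>

lemma eval_poly_in_subalgebra:
  assumes f: "f \<in> carrier (free_algebra G)" and gens: "\<And>g. g \<in> G \<Longrightarrow> \<phi> g \<in> Z"
    and Z: "0 \<in> Z" "1 \<in> Z" "\<And>x y. x \<in> Z \<Longrightarrow> y \<in> Z \<Longrightarrow> x + y \<in> Z"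
      "\<And>x y. x \<in> Z \<Longrightarrow> y \<in> Z \<Longrightarrow> x * y \<in> Z" "\<And>c x. x \<in> Z \<Longrightarrow> c *\<^sub>C x \<in> Z"
  shows "eval_poly \<phi> f \<in> Z"
proof -
  have prod: "prod_list (map \<phi> w) \<in> Z" if "set w \<subseteq> G" for w
    using that by (induction w) (simp_all add: gens Z)
  have sums: "sum h S \<in> Z" if "\<And>w. w \<in> S \<Longrightarrow> h w \<in> Z" for h :: "'a list \<Rightarrow> 'b" and S
    using that by (induction S rule: infinite_finite_induct) (simp_all add: Z)
  show ?thesis
    unfolding eval_poly_def
    by (rule sums, rule Z(5), rule prod) (use f in \<open>auto simp: free_algebra_def\<close>)
qed

lemma ring_End_algebra:
  fixes \<rho> :: "'g \<Rightarrow> 'u::complex_vector \<Rightarrow> 'u"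
  assumes U: "cvec.subspace U" and closed: "\<And>x u. u \<in> U \<Longrightarrow> \<rho> x u \<in> U"
    and add: "\<And>x u v. u \<in> U \<Longrightarrow> v \<in> U \<Longrightarrow> \<rho> x (u + v) = \<rho> x u + \<rho> x v"
    and scale: "\<And>x u c. u \<in> U \<Longrightarrow> \<rho> x (c *\<^sub>C u) = c *\<^sub>C \<rho> x u"
  shows "ring (End_algebra \<rho> U)"
proof -
  note sub = cvec.subspace_0[OF U] cvec.subspace_add[OF U] cvec.subspace_scale[OF U]
    cvec.subspace_neg[OF U]
  have zero: "\<rho> x 0 = 0" for x
    using scale[OF sub(1), of x 0] by simp
  have neg: "\<rho> x (- u) = - \<rho> x u" if "u \<in> U" for x u
    using scale[OF that, of x "-1"] by (simp add: scaleC_one)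
  show ?thesis
  proof (rule ringI)
    show "abelian_group (End_algebra \<rho> U)"
    proof (rule abelian_groupI)
      fix f assume "f \<in> carrier (End_algebra \<rho> U)"
      moreover from this have "f u \<in> U" if "u \<in> U" for u
        using that by (auto simp: End_algebra_def)
      ultimately show "\<exists>g\<in>carrier (End_algebra \<rho> U). g \<oplus>\<^bsub>End_algebra \<rho> U\<^esub> f = \<zero>\<^bsub>End_algebra \<rho> U\<^esub>"
        by (intro bexI[of _ "\<lambda>u\<in>U. - f u"])
          (auto simp: End_algebra_def sub closed neg intro!: PiE_I restrict_ext)
    qed (auto simp: End_algebra_def sub closed add zero algebra_simps PiE_iff
        intro!: restrict_ext extensionalityI[of _ U])
    show "monoid (End_algebra \<rho> U)"
      by (rule monoidI)
        (auto simp: End_algebra_def sub closed compose_def PiE_iff Pi_iff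
          intro!: restrict_ext extensionalityI[of _ U])
  qed (auto simp: End_algebra_def sub closed compose_def PiE_iff Pi_iff intro!: restrict_ext)
qed

lemma restrict_algebra_hom:
  fixes \<rho> :: "'g \<Rightarrow> 'u::complex_vector \<Rightarrow> 'u"
  assumes closed: "\<And>x u. u \<in> U \<Longrightarrow> \<rho> x u \<in> U"
    and f: "\<And>f u. f \<in> carrier (free_algebra G) \<Longrightarrow> u \<in> U \<Longrightarrow> Rep_endo (eval_poly \<phi> f) u \<in> U"
    and c: "\<And>f u x. f \<in> carrier (free_algebra G) \<Longrightarrow> u \<in> U \<Longrightarrow>
      Rep_endo (eval_poly \<phi> f) (\<rho> x u) = \<rho> x (Rep_endo (eval_poly \<phi> f) u)"
    and U: "cvec.subspace U"
  shows "(\<lambda>f. \<lambda>u\<in>U. Rep_endo (eval_poly \<phi> f) u) \<in> algebra_hom (free_algebra G) (End_algebra \<rho> U)"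
  unfolding algebra_hom_def
proof (intro CollectI conjI ballI allI ring_hom_memI)
  note sub = cvec.subspace_add[OF U] cvec.subspace_scale[OF U]
  fix g assume g: "g \<in> carrier (free_algebra G)"
  show "(\<lambda>u\<in>U. Rep_endo (eval_poly \<phi> g) u) \<in> carrier (End_algebra \<rho> U)"
    using f[OF g] c[OF g] by (auto simp: End_algebra_def closed sub endo_add endo_scale)
  show "(\<lambda>u\<in>U. Rep_endo (eval_poly \<phi> (a \<odot>\<^bsub>free_algebra G\<^esub> g)) u) =
      a \<odot>\<^bsub>End_algebra \<rho> U\<^esub> (\<lambda>u\<in>U. Rep_endo (eval_poly \<phi> g) u)" for a
    by (simp add: free_algebra_def End_algebra_def endo_simps cong: restrict_cong)
  fix h assume "h \<in> carrier (free_algebra G)"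
  show "(\<lambda>u\<in>U. Rep_endo (eval_poly \<phi> (h \<otimes>\<^bsub>free_algebra G\<^esub> g)) u) =
      (\<lambda>u\<in>U. Rep_endo (eval_poly \<phi> h) u) \<otimes>\<^bsub>End_algebra \<rho> U\<^esub> (\<lambda>u\<in>U. Rep_endo (eval_poly \<phi> g) u)"
    using f[OF g] by (auto simp: free_algebra_def End_algebra_def endo_simps compose_def intro!: restrict_ext)
  show "(\<lambda>u\<in>U. Rep_endo (eval_poly \<phi> (h \<oplus>\<^bsub>free_algebra G\<^esub> g)) u) =
      (\<lambda>u\<in>U. Rep_endo (eval_poly \<phi> h) u) \<oplus>\<^bsub>End_algebra \<rho> U\<^esub> (\<lambda>u\<in>U. Rep_endo (eval_poly \<phi> g) u)"
    by (auto simp: free_algebra_def End_algebra_def endo_simps intro!: restrict_ext)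
next
  show "(\<lambda>u\<in>U. Rep_endo (eval_poly \<phi> \<one>\<^bsub>free_algebra G\<^esub>) u) = \<one>\<^bsub>End_algebra \<rho> U\<^esub>"
    by (auto simp: free_algebra_def End_algebra_def endo_simps intro!: restrict_ext)
qed

theorem theorem2p1:
  fixes k :: nat
    and br :: "'g::complex_vector \<Rightarrow> 'g \<Rightarrow> 'g"
    and \<theta> :: "'g \<Rightarrow> 'w::complex_vector \<Rightarrow> 'w"
    and \<hh> :: "'g set"
    and d :: nat and b b' :: "nat \<Rightarrow> 'g"
    and \<rho>M :: "'g \<Rightarrow> 'm::complex_vector \<Rightarrow> 'm"
    and \<rho>N :: "'g \<Rightarrow> 'n::complex_vector \<Rightarrow> 'n"
    and \<rho>V :: "'g \<Rightarrow> 'v::complex_vector \<Rightarrow> 'v"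
  defines "act \<equiv> slots_act \<rho>M \<rho>N \<rho>V"
    and "U \<equiv> (tensor_power k :: ('m, 'n, 'v) tensor set)"
  defines "\<kappa> \<equiv> (\<lambda>S. casimir_op d b b' (act S))"
  assumes "finite_dim TYPE('g)" and "reductive br"
    and "finite_dim TYPE('w)" and "lie_module br \<theta>" and "inj \<theta>"
    and "cartan_subalgebra br \<hh>"
    and "nondegenerate_on UNIV (trace_form \<theta>)" and "nondegenerate_on \<hh> (trace_form \<theta>)"
    and "dual_bases (trace_form \<theta>) d b b'"
    and "finite_dim TYPE('m)" and "simple_module br \<rho>M"
    and "finite_dim TYPE('n)" and "simple_module br \<rho>N"
    and "finite_dim TYPE('v)" and "simple_module br \<rho>V"
  shows "\<exists>\<Phi> \<in> algebra_hom (dtb_algebra k)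
                (End_algebra (act ({SlotM, SlotN} \<union> first_copies k)) U).
      (\<forall>i\<in>{1..k}. \<Phi> (dtb_class k (fx i)) =
         (\<lambda>u\<in>U. (1/2) *\<^sub>C (\<kappa> ({SlotM} \<union> first_copies i) u
                             - \<kappa> ({SlotM} \<union> first_copies (i - 1)) u))) \<and>
      (\<forall>i\<in>{1..k}. \<Phi> (dtb_class k (fy i)) =
         (\<lambda>u\<in>U. (1/2) *\<^sub>C (\<kappa> ({SlotN} \<union> first_copies i) u
                             - \<kappa> ({SlotN} \<union> first_copies (i - 1)) u))) \<and>
      (\<forall>i\<in>{1..k}. \<Phi> (dtb_class k (fz i)) =
         (\<lambda>u\<in>U. (1/2) *\<^sub>C (\<kappa> ({SlotM, SlotN} \<union> first_copies i) u
                             - \<kappa> ({SlotM, SlotN} \<union> first_copies (i - 1)) u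
                             + casimir_scalar d b b' \<rho>V *\<^sub>C u))) \<and>
      \<Phi> (dtb_class k (fz 0)) =
         (\<lambda>u\<in>U. (1/2) *\<^sub>C (\<kappa> {SlotM, SlotN} u - \<kappa> {SlotM} u - \<kappa> {SlotN} u)) \<and>
      \<Phi> (dtb_class k (fz 0)) = (\<lambda>u\<in>U. gamma_MN d b b' \<rho>M \<rho>N u) \<and>
      (\<forall>i\<in>{1..<k}. \<Phi> (dtb_class k (fs i)) = (\<lambda>u\<in>U. flip_op i u))"
proof -
  have mods: "lie_module br \<rho>M" "lie_module br \<rho>N" "lie_module br \<rho>V"
    using assms by (auto simp: simple_module_def)
  let ?B = "trace_form \<theta>" and ?c = "casimir_scalar d b b' \<rho>V"
  note bilinear = trace_form_bilinear[OF \<open>finite_dim TYPE('w)\<close> \<open>lie_module br \<theta>\<close>]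
  note dual = \<open>dual_bases ?B d b b'\<close>
  have inv: "\<exists>r. \<forall>i<d. br x (b i) = (\<Sum>j<d. r i j *\<^sub>C b j) \<and>
      br x (b' i) = (\<Sum>j<d. - r j i *\<^sub>C b' j)" for x
    by (rule dual_bases_invariant[OF dual bilinear])
      (rule trace_form_invariant[OF \<open>finite_dim TYPE('w)\<close> \<open>lie_module br \<theta>\<close>])
  note scalar = casimir_op_simple[OF \<open>finite_dim TYPE('v)\<close> \<open>simple_module br \<rho>V\<close> inv]
  define A where "A = slot_endo \<rho>M \<rho>N \<rho>V k"
  define P :: "('m, 'n, 'v) tensor endo" where "P = proj k"
  define T :: "(nat \<Rightarrow> nat) \<Rightarrow> ('m, 'n, 'v) tensor endo" where "T = perm_endo k"
  have PA: "P * A p x = A p x" "A p x * P = A p x" for p x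
    unfolding P_def A_def by (rule slot_endo_proj[OF mods])+
  interpret CO: casimir_operators k d b b' br A T "?c *\<^sub>C P"
  proof (rule casimir_operators.intro)
    fix w w' assume w: "w permutes {1..k}"
    show "?c *\<^sub>C P * T w = T w * ?c *\<^sub>C P"
      by (simp add: P_def T_def scaleC_mult_left scaleC_mult_right perm_endo_proj[OF w])
    show "T w * T w' = T (w \<circ> w')" if "w' permutes {1..k}"
      unfolding T_def using w that by (rule perm_endo_comp)
    show "T w * A p x = A (permute_slot w p) x * T w" if "p \<in> all_slots k" for p x
      unfolding T_def A_def using mods w that by (rule perm_endo_slot_endo)
  next
    fix p assume p: "p \<in> all_slots k"
    show "clinear (A p)"
      unfolding A_def using mods p by (rule slot_endo_linear)
    show "A p (br x y) = A p x * A p y - A p y * A p x" for x y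
      unfolding A_def using mods p by (rule slot_endo_bracket)
    show "A p x * A q y = A q y * A p x" if "q \<in> all_slots k" "p \<noteq> q" for q x y
      unfolding A_def using mods p that by (rule slot_endo_commute)
    show "?c *\<^sub>C P * A p x = A p x * ?c *\<^sub>C P" for x
      by (simp add: PA scaleC_mult_left scaleC_mult_right)
  next
    show "T id = 1"
      unfolding T_def by (rule perm_endo_id)
    show "(\<Sum>i<d. A (SlotV j) (b i) * A (SlotV j) (b' i)) = ?c *\<^sub>C P" if "j \<in> {1..k}" for j
      unfolding A_def P_def using mods scalar that by (rule slot_endo_casimir)
  qed (rule inv)
  let ?G = "dtb_generators k"
  have actU: "act S x u = Rep_endo (CO.slots_op S x) u" if "u \<in> U" for S x u
  proof -
    have "slot_act \<rho>M \<rho>N \<rho>V p x u = Rep_endo (A p x) u" for p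
      using that unfolding A_def U_def by (rule slot_act_eq[OF mods])
    then show ?thesis
      by (simp add: act_def slots_act_def CO.slots_op_def Rep_endo_sum)
  qed
  have P_op: "P * CO.slots_op S x = CO.slots_op S x" "CO.slots_op S x * P = CO.slots_op S x" for S x
    by (simp_all add: CO.slots_op_def sum_distrib_left sum_distrib_right PA)
  have PU: "Rep_endo P u = u" if "u \<in> U" for u
    using that unfolding P_def U_def by (rule proj_tensor_power)
  have op_U: "Rep_endo (CO.slots_op S x) u \<in> U" for S x u
  proof -
    have "Rep_endo (P * CO.slots_op S x) u \<in> U"
      unfolding times_endo.rep_eq P_def U_def by (rule proj_in_tensor_power)
    then show ?thesis by (simp only: P_op)
  qed
  \<comment> \<open>The operator \<open>casimir_op\<close> applies the action twice. Since
    \<open>op_U\<close> keeps the inner value in \<open>U\<close>, the identification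
    \<open>actU\<close> is available for the outer action as well.\<close>
  have \<kappa>U: "\<kappa> S u = Rep_endo (CO.casimir S) u" if "u \<in> U" for S u
    using that by (simp add: \<kappa>_def casimir_op_def CO.casimir_def Rep_endo_sum actU op_U times_endo.rep_eq)
  have P_casimir: "P * CO.casimir S = CO.casimir S * P" for S
  proof -
    have "P * CO.casimir S = CO.casimir S"
      by (simp add: CO.casimir_def sum_distrib_left P_op flip: mult.assoc)
    moreover have "CO.casimir S * P = CO.casimir S"
      by (simp add: CO.casimir_def sum_distrib_right P_op mult.assoc)
    ultimately show ?thesis by simp
  qed
  \<comment> \<open>This commutant is a subalgebra, so checking the generators suffices. Commuting
    with \<open>P\<close> keeps \<open>U\<close> invariant, and commuting with the action on all
    factors gives equivariance.\<close>
  let ?Z = "{e. P * e = e * P \<and> (\<forall>x. CO.slots_op (all_slots k) x * e = e * CO.slots_op (all_slots k) x)}"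
  have eval_Z: "eval_poly CO.gen_op f \<in> ?Z" if "f \<in> carrier (free_algebra ?G)" for f
    using that
  proof (rule eval_poly_in_subalgebra)
    fix g assume g: "g \<in> ?G"
    have "P * CO.gen_op g = CO.gen_op g * P"
      by (rule CO.gen_op_commute[OF P_casimir _ _ g])
        (simp_all add: P_def T_def perm_endo_proj scaleC_mult_left scaleC_mult_right)
    with CO.gen_op_act[OF g] show "CO.gen_op g \<in> ?Z" by simp
  next
    fix e e' assume "e \<in> ?Z" "e' \<in> ?Z"
    then have e: "X * e = e * X" "X * e' = e' * X"
      if "X = P \<or> (\<exists>x. X = CO.slots_op (all_slots k) x)" for X
      using that by auto
    have "X * (e * e') = e * e' * X" if "X = P \<or> (\<exists>x. X = CO.slots_op (all_slots k) x)" for X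
      using e[OF that] by (metis mult.assoc)
    then show "e * e' \<in> ?Z" by blast
  qed (simp_all add: distrib_left distrib_right scaleC_mult_left scaleC_mult_right)
  define h where "h f = (\<lambda>u\<in>U. Rep_endo (eval_poly CO.gen_op f) u)" for f
  have U: "cvec.subspace U"
    unfolding U_def by (rule subspace_tensor_power)
  let ?E = "End_algebra (act (all_slots k)) U"
  have "h \<in> algebra_hom (free_algebra ?G) ?E"
    unfolding h_def[abs_def]
  proof (rule restrict_algebra_hom[OF _ _ _ U])
    show "act (all_slots k) x u \<in> U" if "u \<in> U" for x u
      using that by (simp add: actU op_U)
    fix f u assume f: "f \<in> carrier (free_algebra ?G)" and u: "u \<in> U"
    let ?e = "eval_poly CO.gen_op f"
    have "Rep_endo ?e u = Rep_endo (P * ?e) u"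
      using eval_Z[OF f] PU[OF u] by (simp add: times_endo.rep_eq)
    then show e: "Rep_endo ?e u \<in> U"
      using proj_in_tensor_power[of k "Rep_endo ?e u"] by (simp add: P_def U_def times_endo.rep_eq)
    fix x
    have "?e * CO.slots_op (all_slots k) x = CO.slots_op (all_slots k) x * ?e"
      using eval_Z[OF f] by simp
    from arg_cong[OF this, of "\<lambda>e. Rep_endo e u"]
    show "Rep_endo ?e (act (all_slots k) x u) = act (all_slots k) x (Rep_endo ?e u)"
      unfolding actU[OF u] actU[OF e] times_endo.rep_eq .
  qed
  moreover have "ring ?E"
    by (rule ring_End_algebra[OF U])
      (simp_all add: actU op_U cvec.subspace_add[OF U] cvec.subspace_scale[OF U] endo_add endo_scale)
  moreover have "l \<in> carrier (free_algebra ?G) \<and> r \<in> carrier (free_algebra ?G) \<and> h l = h r"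
    if "(l, r) \<in> dtb_relations k" for l r
    using bspec[OF relations_in_free_algebra that] bspec[OF CO.relations_hold that]
    by (simp add: h_def)
  ultimately obtain \<Phi> where \<Phi>: "\<Phi> \<in> algebra_hom (dtb_algebra k) ?E"
    "\<And>f. f \<in> carrier (free_algebra ?G) \<Longrightarrow> \<Phi> (dtb_class k f) = h f"
    using presented_algebra_universal[of ?E h ?G "dtb_relations k"]
    unfolding dtb_algebra_def dtb_class_def by blast
  note gens = generators_in_free_algebra[where k = k]
  have x: "\<Phi> (dtb_class k (fx i)) =
      (\<lambda>u\<in>U. (1/2) *\<^sub>C (\<kappa> ({SlotM} \<union> first_copies i) u - \<kappa> ({SlotM} \<union> first_copies (i - 1)) u))"
    if "i \<in> {1..k}" for i
    unfolding \<Phi>(2)[OF gens(2)[OF that]] h_def CO.eval_gens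
    by (rule restrict_ext) (simp add: \<kappa>U CO.boundary_op_def endo_simps)
  have y: "\<Phi> (dtb_class k (fy i)) =
      (\<lambda>u\<in>U. (1/2) *\<^sub>C (\<kappa> ({SlotN} \<union> first_copies i) u - \<kappa> ({SlotN} \<union> first_copies (i - 1)) u))"
    if "i \<in> {1..k}" for i
    unfolding \<Phi>(2)[OF gens(3)[OF that]] h_def CO.eval_gens
    by (rule restrict_ext) (simp add: \<kappa>U CO.boundary_op_def endo_simps)
  have z: "\<Phi> (dtb_class k (fz i)) =
      (\<lambda>u\<in>U. (1/2) *\<^sub>C (\<kappa> ({SlotM, SlotN} \<union> first_copies i) u
        - \<kappa> ({SlotM, SlotN} \<union> first_copies (i - 1)) u + ?c *\<^sub>C u))"
    if "i \<in> {1..k}" for i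
  proof -
    from that have "i \<in> {0..k}" "i \<noteq> 0" by auto
    then show ?thesis
      unfolding \<Phi>(2)[OF gens(4)[OF \<open>i \<in> {0..k}\<close>]] h_def CO.eval_gens
      by (intro restrict_ext)
        (simp add: \<kappa>U PU CO.z_op_def CO.boundary_op_def endo_simps scaleC_add_right)
  qed
  have h0: "\<Phi> (dtb_class k (fz 0)) = (\<lambda>u\<in>U. Rep_endo (CO.z_op 0) u)"
    by (simp add: \<Phi>(2)[OF gens(4)] h_def)
  have z0: "\<Phi> (dtb_class k (fz 0)) =
      (\<lambda>u\<in>U. (1/2) *\<^sub>C (\<kappa> {SlotM, SlotN} u - \<kappa> {SlotM} u - \<kappa> {SlotN} u))"
    unfolding h0 by (rule restrict_ext) (simp add: \<kappa>U CO.z_op_def endo_simps)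
  \<comment> \<open>By \<open>casimir_insert\<close>, \<open>z_op 0\<close> is half of a cross term
    with two summands. Commuting M past N and using the symmetry of the Casimir tensor shows that
    both summands equal \<open>?g\<close>.\<close>
  have "CO.z_op 0 = (\<Sum>i<d. A SlotM (b i) * A SlotN (b' i))" (is "_ = ?g")
  proof -
    have "(\<Sum>i<d. A SlotM (b i) * A SlotN (b' i)) = (\<Sum>i<d. A SlotM (b' i) * A SlotN (b i))"
      by (rule dual_bases_symmetric[OF dual bilinear trace_form_commute
            [OF \<open>finite_dim TYPE('w)\<close> \<open>lie_module br \<theta>\<close>]])
        (rule clinearI; simp add: CO.A_linear clinear_add clinear_scale distrib_left distrib_right
          scaleC_mult_left scaleC_mult_right)+
    then have "CO.cross SlotN SlotM = ?g + ?g"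
      using CO.A_commute[of SlotN SlotM] by (simp add: CO.cross_def sum.distrib)
    then have "CO.z_op 0 = (1/2) *\<^sub>C (?g + ?g)"
      using CO.casimir_insert[of SlotM "{SlotN}"] by (simp add: CO.z_op_def)
    also have "\<dots> = ?g"
      by (simp add: scaleC_add_right scaleC_one flip: scaleC_add_left)
    finally show ?thesis .
  qed
  then have gamma: "\<Phi> (dtb_class k (fz 0)) = (\<lambda>u\<in>U. gamma_MN d b b' \<rho>M \<rho>N u)"
    unfolding h0 by (intro restrict_ext) (simp add: U_def A_def gamma_MN_eq[OF mods])
  have t: "\<Phi> (dtb_class k (fs i)) = (\<lambda>u\<in>U. flip_op i u)" if "i \<in> {1..<k}" for i
    unfolding \<Phi>(2)[OF gens(1)[OF sref_permutes[OF that]]] h_def CO.eval_gens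
    by (rule restrict_ext) (simp add: flip_op_eq[OF that] U_def T_def)
  show ?thesis
    using \<Phi>(1) x y z z0 gamma t by blast
qed

end
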